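(* Let $i\colon\mathcal A\to\mathcal G$ be a pair of groupoids, and let $V$ and $W$ be Banach $\mathcal G$-modules. Let $(I^\ast,J^\ast,\varphi^\ast)$ be a relatively injective $(\mathcal G,\mathcal A)$-cochain complex and $(\varepsilon,\varepsilon')\colon(W,i^\ast W,\mathrm{id}_{i^\ast W})\to(I^0,J^0,\varphi^0)$ a $(\mathcal G,\mathcal A)$-augmentation map. Let $(C^\ast,D^\ast,\psi^\ast,(\nu,\nu'))$ be a strong $(\mathcal G,\mathcal A)$-resolution of $V$. Let $(f,f')\colon(V,i^\ast V,\mathrm{id}_{i^\ast V})\to(W,i^\ast W,\mathrm{id}_{i^\ast W})$ be a $(\mathcal G,\mathcal A)$-map. Then there exists an extension of $(f,f')$ to a bounded $(\mathcal G,\mathcal A)$-cochain map from the resolution $(C^\ast,D^\ast,\psi^\ast,(\nu,\nu'))$ to the augmented cochain complex $(I^\ast,J^\ast,\varphi^\ast,(\varepsilon,\varepsilon'))$. This extension is unique up to bounded $(\mathcal G,\mathcal A)$-cochain homotopy.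
   Context: **Groupoids and modules.** A groupoid $\mathcal G$ is a small category in which all morphisms are invertible; $g\in\mathcal G$ means that $g$ is a morphism, with source $s(g)$ and target $t(g)$. A pair of groupoids is a functor $i\colon\mathcal A\to\mathcal G$ of groupoids injective on objects and morphisms. A normed $\mathcal G$-module $V=(V_e)_{e\in\mathrm{ob}\,\mathcal G}$ is a family of normed real vector spaces with linear isometries $V_{s(g)}\to V_{t(g)}$, $v\mapsto g\cdot v$ ($g\in\mathcal G$), satisfying $g\cdot(h\cdot v)=(gh)\cdot v$ and $\mathrm{id}_e\cdot v=v$; it is a Banach $\mathcal G$-module if each $V_e$ is complete. An $\mathbb R$-morphism $f\colon V\to W$ is a family of bounded linear maps $f_e\colon V_e\to W_e$ with $\|f\|_\infty=\sup_e\|f_e\|<\infty$; it is a $\mathcal G$-map if it is equivariant. $i^\ast V$ is the $\mathcal A$-module $(V_{i(a)})_{a\in\mathrm{ob}\,\mathcal A}$ with action through $i$, and $i^\ast f=(f_{i(a)})_a$. **$(\mathcal G,\mathcal A)$-modules.** A $(\mathcal G,\mathcal A)$-module is a triple $(V_0,V_1,\varphi)$ of a Banach $\mathcal G$-module $V_0$, a Banach $\mathcal A$-module $V_1$ and a bounded $\mathcal A$-map $\varphi\colon i^\ast V_0\to V_1$. A $(\mathcal G,\mathcal A)$-map $(j,j')\colon(V_0,V_1,\varphi)\to(W_0,W_1,\psi)$ is a $\mathcal G$-map $j\colon V_0\to W_0$ and an $\mathcal A$-map $j'\colon V_1\to W_1$ with $\psi\circ i^\ast j=j'\circ\varphi$;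 dropping equivariance of $j,j'$ but keeping this relation gives not necessarily equivariant morphisms. $(j,j')$ is relatively injective if there is a not necessarily equivariant morphism $(\sigma,\sigma')\colon(W_0,W_1,\psi)\to(V_0,V_1,\varphi)$ with $\sigma j=\mathrm{id}$, $\sigma'j'=\mathrm{id}$, $\|\sigma\|_\infty\le1$, $\|\sigma'\|_\infty\le1$. A $(\mathcal G,\mathcal A)$-module $I=(I_0,I_1,f)$ is relatively injective if for each relatively injective $(\mathcal G,\mathcal A)$-map $(j,j')\colon(V_0,V_1,\varphi)\to(W_0,W_1,\psi)$ and each $(\mathcal G,\mathcal A)$-map $(\alpha,\alpha')\colon(V_0,V_1,\varphi)\to I$ there is a $(\mathcal G,\mathcal A)$-map $(\beta,\beta')\colon(W_0,W_1,\psi)\to I$ with $(\beta,\beta')\circ(j,j')=(\alpha,\alpha')$, $\|\beta\|_\infty\le\|\alpha\|_\infty$, $\|\beta'\|_\infty\le\|\alpha'\|_\infty$. **Resolutions.** A Banach $(\mathcal G,\mathcal A)$-cochain complex $(C^\ast,D^\ast,\psi^\ast)$ is a cochain complex (indexed by $\mathbb N$) of $(\mathcal G,\mathcal A)$-modules and $(\mathcal G,\mathcal A)$-maps: $C^\ast$ is a Banach $\mathcal G$-cochain complex, $D^\ast$ a Banach $\mathcal A$-cochain complex, $\psi^\ast\colon i^\ast C^\ast\to D^\ast$ an $\mathcal A$-cochain map. It is relatively injective if it is so in each degree. An augmentation is a $(\mathcal G,\mathcal A)$-map $(\nu,\nu')\colon(V,i^\ast V,\mathrm{id})\to(C^0,D^0,\psi^0)$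 whose composition with the coboundary in degree $0$ vanishes. $(C^\ast,D^\ast,\psi^\ast,(\nu,\nu'))$ is a strong resolution of $V$ if there are cochain contractions $s^\ast$ of $(C^\ast,\nu)$ and $t^\ast$ of $(D^\ast,\nu')$, consisting of not necessarily equivariant $\mathbb R$-morphisms of norm $\le1$, such that $\psi^\ast$ commutes with $i^\ast s^\ast$ and $t^\ast$. (A cochain contraction of $(C^\ast,\nu)$: maps $s^n\colon C^n\to C^{n-1}$, $n>0$, and $s^0\colon C^0\to V$ with $s^0\nu=\mathrm{id}$, $s^1\delta^0+\nu s^0=\mathrm{id}$, $s^{n+1}\delta^n+\delta^{n-1}s^n=\mathrm{id}$ for $n\ge1$.) **Extensions and homotopies.** A bounded $(\mathcal G,\mathcal A)$-cochain map is a degreewise $(\mathcal G,\mathcal A)$-map commuting with coboundaries (boundedness is required in each degree); it extends $(f,f')$ if in degree $0$ it satisfies $F^0\circ\nu=\varepsilon\circ f$ and $F'^0\circ\nu'=\varepsilon'\circ f'$. A bounded $(\mathcal G,\mathcal A)$-cochain homotopy is a family of $(\mathcal G,\mathcal A)$-maps $(h_0^n,h_1^n)$ of degree $-1$ such that $h_0^\ast$ is a $\mathcal G$-cochain homotopy and $h_1^\ast$ an $\mathcal A$-cochain homotopy between the respective components. *)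

theory Defs
  imports "HOL-Analysis.Analysis"
begin

section \<open>Groupoids and pairs of groupoids\<close>

text \<open>The composite \<open>gcomp G g h\<close> is ``\<open>g\<close> after \<open>h\<close>''; it is meaningful when the source of
  \<open>g\<close> is the target of \<open>h\<close>.\<close>

record ('o, 'm) groupoid =
  Ob :: "'o set"
  Mor :: "'m set"
  src :: "'m \<Rightarrow> 'o"
  tgt :: "'m \<Rightarrow> 'o"
  ident :: "'o \<Rightarrow> 'm"
  gcomp :: "'m \<Rightarrow> 'm \<Rightarrow> 'm"

definition is_groupoid :: "('o, 'm) groupoid \<Rightarrow> bool" where
  "is_groupoid G \<longleftrightarrow>
     (\<forall>g\<in>Mor G. src G g \<in> Ob G \<and> tgt G g \<in> Ob G) \<and>
     (\<forall>e\<in>Ob G. ident G e \<in> Mor G \<and> src G (ident G e) = e \<and> tgt G (ident G e) = e) \<and>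
     (\<forall>g\<in>Mor G. \<forall>h\<in>Mor G. src G g = tgt G h \<longrightarrow>
        gcomp G g h \<in> Mor G \<and> src G (gcomp G g h) = src G h \<and> tgt G (gcomp G g h) = tgt G g) \<and>
     (\<forall>g\<in>Mor G. gcomp G g (ident G (src G g)) = g \<and> gcomp G (ident G (tgt G g)) g = g) \<and>
     (\<forall>g\<in>Mor G. \<forall>h\<in>Mor G. \<forall>k\<in>Mor G. src G g = tgt G h \<and> src G h = tgt G k \<longrightarrow>
        gcomp G (gcomp G g h) k = gcomp G g (gcomp G h k)) \<and>
     (\<forall>g\<in>Mor G. \<exists>h\<in>Mor G. src G h = tgt G g \<and> tgt G h = src G g \<and>
        gcomp G h g = ident G (src G g) \<and> gcomp G g h = ident G (tgt G g))"

definition is_groupoid_functor ::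
  "('p, 'q) groupoid \<Rightarrow> ('o, 'm) groupoid \<Rightarrow> ('p \<Rightarrow> 'o) \<Rightarrow> ('q \<Rightarrow> 'm) \<Rightarrow> bool" where
  "is_groupoid_functor A G Fo Fm \<longleftrightarrow>
     (\<forall>e\<in>Ob A. Fo e \<in> Ob G) \<and>
     (\<forall>a\<in>Mor A. Fm a \<in> Mor G \<and> src G (Fm a) = Fo (src A a) \<and> tgt G (Fm a) = Fo (tgt A a)) \<and>
     (\<forall>e\<in>Ob A. Fm (ident A e) = ident G (Fo e)) \<and>
     (\<forall>a\<in>Mor A. \<forall>b\<in>Mor A. src A a = tgt A b \<longrightarrow> Fm (gcomp A a b) = gcomp G (Fm a) (Fm b))"

record ('o, 'm, 'p, 'q) gpair =
  grpG :: "('o, 'm) groupoid"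
  grpA :: "('p, 'q) groupoid"
  iOb :: "'p \<Rightarrow> 'o"
  iMor :: "'q \<Rightarrow> 'm"

definition is_groupoid_pair :: "('o, 'm, 'p, 'q) gpair \<Rightarrow> bool" where
  "is_groupoid_pair P \<longleftrightarrow>
     is_groupoid (grpG P) \<and> is_groupoid (grpA P) \<and>
     is_groupoid_functor (grpA P) (grpG P) (iOb P) (iMor P) \<and>
     inj_on (iOb P) (Ob (grpA P)) \<and> inj_on (iMor P) (Mor (grpA P))"


section \<open>Normed and Banach modules over a groupoid\<close>

text \<open>
  The spaces $V_e$ of a module vary with the object $e$, which a family of HOL types cannot express.
  All of them are therefore linear subspaces of one real vector space \<open>'u\<close>, each carrying a norm of
  its own, unrelated to any norm on \<open>'u\<close> and to the norms at the other objects.  The type \<open>'u\<close>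
  serves as the universe of vector spaces: any set of real vector spaces embeds
  linearly into a sufficiently large \<open>'u\<close>.  The distinct \<open>V\<^sub>e\<close> may overlap inside \<open>'u\<close>; this is
  immaterial, since they are never compared.
\<close>

definition normed_space_on :: "'u::real_vector set \<Rightarrow> ('u \<Rightarrow> real) \<Rightarrow> bool" where
  "normed_space_on S N \<longleftrightarrow> subspace S \<and>
     (\<forall>x\<in>S. 0 \<le> N x \<and> (N x = 0 \<longleftrightarrow> x = 0)) \<and>
     (\<forall>x\<in>S. \<forall>y\<in>S. N (x + y) \<le> N x + N y) \<and>
     (\<forall>c. \<forall>x\<in>S. N (c *\<^sub>R x) = \<bar>c\<bar> * N x)"

definition complete_norm_on :: "'u::real_vector set \<Rightarrow> ('u \<Rightarrow> real) \<Rightarrow> bool" where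
  "complete_norm_on S N \<longleftrightarrow>
     (\<forall>X :: nat \<Rightarrow> 'u. (\<forall>n. X n \<in> S) \<and> (\<forall>\<epsilon>>0. \<exists>M. \<forall>m\<ge>M. \<forall>n\<ge>M. N (X m - X n) < \<epsilon>) \<longrightarrow>
        (\<exists>x\<in>S. (\<lambda>n. N (X n - x)) \<longlonglongrightarrow> 0))"

definition linear_map_on ::
  "'u::real_vector set \<Rightarrow> 'w::real_vector set \<Rightarrow> ('u \<Rightarrow> 'w) \<Rightarrow> bool" where
  "linear_map_on S T f \<longleftrightarrow> (\<forall>x\<in>S. f x \<in> T) \<and>
     (\<forall>x\<in>S. \<forall>y\<in>S. f (x + y) = f x + f y) \<and> (\<forall>c. \<forall>x\<in>S. f (c *\<^sub>R x) = c *\<^sub>R f x)"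

record ('o, 'm, 'u) gmodule =
  fib :: "'o \<Rightarrow> 'u set"
  nrm :: "'o \<Rightarrow> 'u \<Rightarrow> real"
  act :: "'m \<Rightarrow> 'u \<Rightarrow> 'u"

definition normed_module :: "('o, 'm) groupoid \<Rightarrow> ('o, 'm, 'u::real_vector) gmodule \<Rightarrow> bool" where
  "normed_module G V \<longleftrightarrow>
     (\<forall>e\<in>Ob G. normed_space_on (fib V e) (nrm V e)) \<and>
     (\<forall>g\<in>Mor G. linear_map_on (fib V (src G g)) (fib V (tgt G g)) (act V g) \<and>
        (\<forall>v\<in>fib V (src G g). nrm V (tgt G g) (act V g v) = nrm V (src G g) v)) \<and>
     (\<forall>g\<in>Mor G. \<forall>h\<in>Mor G. src G g = tgt G h \<longrightarrow>
        (\<forall>v\<in>fib V (src G h). act V g (act V h v) = act V (gcomp G g h) v)) \<and>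
     (\<forall>e\<in>Ob G. \<forall>v\<in>fib V e. act V (ident G e) v = v)"

definition banach_module :: "('o, 'm) groupoid \<Rightarrow> ('o, 'm, 'u::real_vector) gmodule \<Rightarrow> bool" where
  "banach_module G V \<longleftrightarrow>
     normed_module G V \<and> (\<forall>e\<in>Ob G. complete_norm_on (fib V e) (nrm V e))"

text \<open>Families of maps indexed by objects; the values outside the fibres are irrelevant, so two
  families are compared with \<open>fam_eq\<close> rather than \<open>=\<close>.\<close>

type_synonym ('o, 'u) fam = "'o \<Rightarrow> 'u \<Rightarrow> 'u"

definition fam_id :: "('o, 'u) fam" where
  "fam_id = (\<lambda>e x. x)"

definition fam_comp :: "('o, 'u) fam \<Rightarrow> ('o, 'u) fam \<Rightarrow> ('o, 'u) fam" (infixr "\<odot>" 75) where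
  "g \<odot> f = (\<lambda>e x. g e (f e x))"

definition fam_add :: "('o, 'u::real_vector) fam \<Rightarrow> ('o, 'u) fam \<Rightarrow> ('o, 'u) fam"
    (infixl "\<oplus>\<^sub>f" 65) where
  "f \<oplus>\<^sub>f g = (\<lambda>e x. f e x + g e x)"

definition fam_diff :: "('o, 'u::real_vector) fam \<Rightarrow> ('o, 'u) fam \<Rightarrow> ('o, 'u) fam"
    (infixl "\<ominus>\<^sub>f" 65) where
  "f \<ominus>\<^sub>f g = (\<lambda>e x. f e x - g e x)"

definition fam_zero :: "('o, 'u::real_vector) fam" where
  "fam_zero = (\<lambda>e x. 0)"

definition fam_eq ::
  "('o, 'm) groupoid \<Rightarrow> ('o, 'm, 'u) gmodule \<Rightarrow> ('o, 'u) fam \<Rightarrow> ('o, 'u) fam \<Rightarrow> bool" where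
  "fam_eq G V f g \<longleftrightarrow> (\<forall>e\<in>Ob G. \<forall>x\<in>fib V e. f e x = g e x)"

text \<open>The norms live in \<^typ>\<open>ennreal\<close>, so that they are defined for unbounded maps as well
  (with value \<open>\<infinity>\<close>) and the supremum over an empty set of objects is \<open>0\<close>.\<close>

definition op_norm_on :: "'u set \<Rightarrow> ('u \<Rightarrow> real) \<Rightarrow> ('u \<Rightarrow> real) \<Rightarrow> ('u \<Rightarrow> 'u) \<Rightarrow> ennreal" where
  "op_norm_on S N N' f = (SUP x\<in>{x\<in>S. N x \<le> 1}. ennreal (N' (f x)))"

definition sup_norm ::
  "('o, 'm) groupoid \<Rightarrow> ('o, 'm, 'u) gmodule \<Rightarrow> ('o, 'm, 'u) gmodule \<Rightarrow> ('o, 'u) fam \<Rightarrow> ennreal" where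
  "sup_norm G V W f = (SUP e\<in>Ob G. op_norm_on (fib V e) (nrm V e) (nrm W e) (f e))"

definition is_morphism ::
  "('o, 'm) groupoid \<Rightarrow> ('o, 'm, 'u::real_vector) gmodule \<Rightarrow> ('o, 'm, 'u) gmodule \<Rightarrow>
    ('o, 'u) fam \<Rightarrow> bool" where
  "is_morphism G V W f \<longleftrightarrow>
     (\<forall>e\<in>Ob G. linear_map_on (fib V e) (fib W e) (f e)) \<and> sup_norm G V W f < \<infinity>"

definition is_gmap ::
  "('o, 'm) groupoid \<Rightarrow> ('o, 'm, 'u::real_vector) gmodule \<Rightarrow> ('o, 'm, 'u) gmodule \<Rightarrow>
    ('o, 'u) fam \<Rightarrow> bool" where
  "is_gmap G V W f \<longleftrightarrow> is_morphism G V W f \<and>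
     (\<forall>g\<in>Mor G. \<forall>v\<in>fib V (src G g). f (tgt G g) (act V g v) = act W g (f (src G g) v))"

definition pull_module ::
  "('o, 'm, 'p, 'q) gpair \<Rightarrow> ('o, 'm, 'u) gmodule \<Rightarrow> ('p, 'q, 'u) gmodule" where
  "pull_module P V = \<lparr>fib = \<lambda>a. fib V (iOb P a), nrm = \<lambda>a. nrm V (iOb P a),
     act = \<lambda>a. act V (iMor P a)\<rparr>"

definition pull_fam :: "('o, 'm, 'p, 'q) gpair \<Rightarrow> ('o, 'u) fam \<Rightarrow> ('p, 'u) fam" where
  "pull_fam P f = (\<lambda>a. f (iOb P a))"


section \<open>Modules over a pair of groupoids\<close>

record ('o, 'm, 'p, 'q, 'u) ga_module =
  modG :: "('o, 'm, 'u) gmodule"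
  modA :: "('p, 'q, 'u) gmodule"
  conn :: "('p, 'u) fam"

definition is_ga_module ::
  "('o, 'm, 'p, 'q) gpair \<Rightarrow> ('o, 'm, 'p, 'q, 'u::real_vector) ga_module \<Rightarrow> bool" where
  "is_ga_module P M \<longleftrightarrow>
     banach_module (grpG P) (modG M) \<and> banach_module (grpA P) (modA M) \<and>
     is_gmap (grpA P) (pull_module P (modG M)) (modA M) (conn M)"

definition diag_module ::
  "('o, 'm, 'p, 'q) gpair \<Rightarrow> ('o, 'm, 'u) gmodule \<Rightarrow> ('o, 'm, 'p, 'q, 'u) ga_module" where
  "diag_module P V = \<lparr>modG = V, modA = pull_module P V, conn = fam_id\<rparr>"

definition ga_compatible ::
  "('o, 'm, 'p, 'q) gpair \<Rightarrow> ('o, 'm, 'p, 'q, 'u) ga_module \<Rightarrow> ('o, 'm, 'p, 'q, 'u) ga_module \<Rightarrow>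
    ('o, 'u) fam \<Rightarrow> ('p, 'u) fam \<Rightarrow> bool" where
  "ga_compatible P M N j j' \<longleftrightarrow>
     fam_eq (grpA P) (pull_module P (modG M)) (conn N \<odot> pull_fam P j) (j' \<odot> conn M)"

definition is_ga_morphism ::
  "('o, 'm, 'p, 'q) gpair \<Rightarrow> ('o, 'm, 'p, 'q, 'u::real_vector) ga_module \<Rightarrow>
    ('o, 'm, 'p, 'q, 'u) ga_module \<Rightarrow> ('o, 'u) fam \<Rightarrow> ('p, 'u) fam \<Rightarrow> bool" where
  "is_ga_morphism P M N j j' \<longleftrightarrow>
     is_morphism (grpG P) (modG M) (modG N) j \<and> is_morphism (grpA P) (modA M) (modA N) j' \<and>
     ga_compatible P M N j j'"

definition is_ga_map ::
  "('o, 'm, 'p, 'q) gpair \<Rightarrow> ('o, 'm, 'p, 'q, 'u::real_vector) ga_module \<Rightarrow>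
    ('o, 'm, 'p, 'q, 'u) ga_module \<Rightarrow> ('o, 'u) fam \<Rightarrow> ('p, 'u) fam \<Rightarrow> bool" where
  "is_ga_map P M N j j' \<longleftrightarrow>
     is_gmap (grpG P) (modG M) (modG N) j \<and> is_gmap (grpA P) (modA M) (modA N) j' \<and>
     ga_compatible P M N j j'"

definition rel_injective_map ::
  "('o, 'm, 'p, 'q) gpair \<Rightarrow> ('o, 'm, 'p, 'q, 'u::real_vector) ga_module \<Rightarrow>
    ('o, 'm, 'p, 'q, 'u) ga_module \<Rightarrow> ('o, 'u) fam \<Rightarrow> ('p, 'u) fam \<Rightarrow> bool" where
  "rel_injective_map P M N j j' \<longleftrightarrow> is_ga_map P M N j j' \<and>
     (\<exists>\<sigma> \<sigma>'. is_ga_morphism P N M \<sigma> \<sigma>' \<and>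
        fam_eq (grpG P) (modG M) (\<sigma> \<odot> j) fam_id \<and> fam_eq (grpA P) (modA M) (\<sigma>' \<odot> j') fam_id \<and>
        sup_norm (grpG P) (modG N) (modG M) \<sigma> \<le> 1 \<and> sup_norm (grpA P) (modA N) (modA M) \<sigma>' \<le> 1)"

text \<open>The test modules range over all modules in the universe \<open>'u\<close>.\<close>

definition rel_injective_module ::
  "('o, 'm, 'p, 'q) gpair \<Rightarrow> ('o, 'm, 'p, 'q, 'u::real_vector) ga_module \<Rightarrow> bool" where
  "rel_injective_module P I \<longleftrightarrow> is_ga_module P I \<and>
     (\<forall>(M :: ('o, 'm, 'p, 'q, 'u) ga_module) (N :: ('o, 'm, 'p, 'q, 'u) ga_module) j j' \<alpha> \<alpha>'.
        is_ga_module P M \<and> is_ga_module P N \<and> rel_injective_map P M N j j' \<and>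
        is_ga_map P M I \<alpha> \<alpha>' \<longrightarrow>
        (\<exists>\<beta> \<beta>'. is_ga_map P N I \<beta> \<beta>' \<and>
           fam_eq (grpG P) (modG M) (\<beta> \<odot> j) \<alpha> \<and> fam_eq (grpA P) (modA M) (\<beta>' \<odot> j') \<alpha>' \<and>
           sup_norm (grpG P) (modG N) (modG I) \<beta> \<le> sup_norm (grpG P) (modG M) (modG I) \<alpha> \<and>
           sup_norm (grpA P) (modA N) (modA I) \<beta>' \<le> sup_norm (grpA P) (modA M) (modA I) \<alpha>'))"


section \<open>Cochain complexes and strong resolutions\<close>

definition is_cochain_complex ::
  "('o, 'm) groupoid \<Rightarrow> (nat \<Rightarrow> ('o, 'm, 'u::real_vector) gmodule) \<Rightarrow> (nat \<Rightarrow> ('o, 'u) fam) \<Rightarrow> bool"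
where
  "is_cochain_complex G C d \<longleftrightarrow>
     (\<forall>n. banach_module G (C n)) \<and> (\<forall>n. is_gmap G (C n) (C (Suc n)) (d n)) \<and>
     (\<forall>n. fam_eq G (C n) (d (Suc n) \<odot> d n) fam_zero)"

definition is_cochain_contraction ::
  "('o, 'm) groupoid \<Rightarrow> ('o, 'm, 'u::real_vector) gmodule \<Rightarrow> (nat \<Rightarrow> ('o, 'm, 'u) gmodule) \<Rightarrow>
    (nat \<Rightarrow> ('o, 'u) fam) \<Rightarrow> ('o, 'u) fam \<Rightarrow> (nat \<Rightarrow> ('o, 'u) fam) \<Rightarrow> bool" where
  "is_cochain_contraction G V C d \<nu> s \<longleftrightarrow>
     is_morphism G (C 0) V (s 0) \<and> (\<forall>n. is_morphism G (C (Suc n)) (C n) (s (Suc n))) \<and>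
     fam_eq G V (s 0 \<odot> \<nu>) fam_id \<and>
     fam_eq G (C 0) ((s 1 \<odot> d 0) \<oplus>\<^sub>f (\<nu> \<odot> s 0)) fam_id \<and>
     (\<forall>n. fam_eq G (C (Suc n)) ((s (Suc (Suc n)) \<odot> d (Suc n)) \<oplus>\<^sub>f (d n \<odot> s (Suc n))) fam_id)"

record ('o, 'm, 'p, 'q, 'u) ga_complex =
  cxG :: "nat \<Rightarrow> ('o, 'm, 'u) gmodule"
  cxA :: "nat \<Rightarrow> ('p, 'q, 'u) gmodule"
  cxconn :: "nat \<Rightarrow> ('p, 'u) fam"
  dG :: "nat \<Rightarrow> ('o, 'u) fam"
  dA :: "nat \<Rightarrow> ('p, 'u) fam"

definition cx_deg :: "('o, 'm, 'p, 'q, 'u) ga_complex \<Rightarrow> nat \<Rightarrow> ('o, 'm, 'p, 'q, 'u) ga_module" where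
  "cx_deg K n = \<lparr>modG = cxG K n, modA = cxA K n, conn = cxconn K n\<rparr>"

text \<open>That the coboundaries are maps of \<open>(\<G>,\<A>)\<close>-modules says exactly that \<open>cxconn\<close> is a cochain
  map from the pullback of \<open>cxG\<close> to \<open>cxA\<close>.\<close>

definition is_ga_complex ::
  "('o, 'm, 'p, 'q) gpair \<Rightarrow> ('o, 'm, 'p, 'q, 'u::real_vector) ga_complex \<Rightarrow> bool" where
  "is_ga_complex P K \<longleftrightarrow>
     is_cochain_complex (grpG P) (cxG K) (dG K) \<and> is_cochain_complex (grpA P) (cxA K) (dA K) \<and>
     (\<forall>n. is_ga_module P (cx_deg K n)) \<and>
     (\<forall>n. is_ga_map P (cx_deg K n) (cx_deg K (Suc n)) (dG K n) (dA K n))"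

definition rel_injective_complex ::
  "('o, 'm, 'p, 'q) gpair \<Rightarrow> ('o, 'm, 'p, 'q, 'u::real_vector) ga_complex \<Rightarrow> bool" where
  "rel_injective_complex P K \<longleftrightarrow>
     is_ga_complex P K \<and> (\<forall>n. rel_injective_module P (cx_deg K n))"

definition is_augmentation ::
  "('o, 'm, 'p, 'q) gpair \<Rightarrow> ('o, 'm, 'u::real_vector) gmodule \<Rightarrow> ('o, 'm, 'p, 'q, 'u) ga_complex \<Rightarrow>
    ('o, 'u) fam \<Rightarrow> ('p, 'u) fam \<Rightarrow> bool" where
  "is_augmentation P V K \<nu> \<nu>' \<longleftrightarrow>
     is_ga_map P (diag_module P V) (cx_deg K 0) \<nu> \<nu>' \<and>
     fam_eq (grpG P) V (dG K 0 \<odot> \<nu>) fam_zero \<and>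
     fam_eq (grpA P) (pull_module P V) (dA K 0 \<odot> \<nu>') fam_zero"

text \<open>In degree 0 the contractions commute with the connecting maps in the form
  \<open>i\<^sup>*s\<^sup>0 = t\<^sup>0 \<odot> \<psi>\<^sup>0\<close>, the connecting map of \<open>diag_module P V\<close> being the identity.\<close>

definition is_strong_resolution ::
  "('o, 'm, 'p, 'q) gpair \<Rightarrow> ('o, 'm, 'u::real_vector) gmodule \<Rightarrow> ('o, 'm, 'p, 'q, 'u) ga_complex \<Rightarrow>
    ('o, 'u) fam \<Rightarrow> ('p, 'u) fam \<Rightarrow> bool" where
  "is_strong_resolution P V K \<nu> \<nu>' \<longleftrightarrow>
     is_ga_complex P K \<and> is_augmentation P V K \<nu> \<nu>' \<and>
     (\<exists>s t. is_cochain_contraction (grpG P) V (cxG K) (dG K) \<nu> s \<and>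
        is_cochain_contraction (grpA P) (pull_module P V) (cxA K) (dA K) \<nu>' t \<and>
        sup_norm (grpG P) (cxG K 0) V (s 0) \<le> 1 \<and>
        (\<forall>n. sup_norm (grpG P) (cxG K (Suc n)) (cxG K n) (s (Suc n)) \<le> 1) \<and>
        sup_norm (grpA P) (cxA K 0) (pull_module P V) (t 0) \<le> 1 \<and>
        (\<forall>n. sup_norm (grpA P) (cxA K (Suc n)) (cxA K n) (t (Suc n)) \<le> 1) \<and>
        ga_compatible P (cx_deg K 0) (diag_module P V) (s 0) (t 0) \<and>
        (\<forall>n. ga_compatible P (cx_deg K (Suc n)) (cx_deg K n) (s (Suc n)) (t (Suc n))))"


section \<open>Extensions and homotopies\<close>

definition is_ga_cochain_map ::
  "('o, 'm, 'p, 'q) gpair \<Rightarrow> ('o, 'm, 'p, 'q, 'u::real_vector) ga_complex \<Rightarrow>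
    ('o, 'm, 'p, 'q, 'u) ga_complex \<Rightarrow> (nat \<Rightarrow> ('o, 'u) fam) \<Rightarrow> (nat \<Rightarrow> ('p, 'u) fam) \<Rightarrow> bool" where
  "is_ga_cochain_map P K L F F' \<longleftrightarrow>
     (\<forall>n. is_ga_map P (cx_deg K n) (cx_deg L n) (F n) (F' n)) \<and>
     (\<forall>n. fam_eq (grpG P) (cxG K n) (F (Suc n) \<odot> dG K n) (dG L n \<odot> F n)) \<and>
     (\<forall>n. fam_eq (grpA P) (cxA K n) (F' (Suc n) \<odot> dA K n) (dA L n \<odot> F' n))"

definition extends_map ::
  "('o, 'm, 'p, 'q) gpair \<Rightarrow> ('o, 'm, 'u::real_vector) gmodule \<Rightarrow>
    ('o, 'u) fam \<Rightarrow> ('p, 'u) fam \<Rightarrow> ('o, 'u) fam \<Rightarrow> ('p, 'u) fam \<Rightarrow>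
    ('o, 'u) fam \<Rightarrow> ('p, 'u) fam \<Rightarrow> (nat \<Rightarrow> ('o, 'u) fam) \<Rightarrow> (nat \<Rightarrow> ('p, 'u) fam) \<Rightarrow> bool" where
  "extends_map P V \<nu> \<nu>' \<epsilon> \<epsilon>' f f' F F' \<longleftrightarrow>
     fam_eq (grpG P) V (F 0 \<odot> \<nu>) (\<epsilon> \<odot> f) \<and>
     fam_eq (grpA P) (pull_module P V) (F' 0 \<odot> \<nu>') (\<epsilon>' \<odot> f')"

text \<open>A homotopy between cochain maps, with \<open>h n\<close> going from degree \<open>n + 1\<close> to degree \<open>n\<close>; its
  component out of degree \<open>0\<close> is zero, as the complexes are indexed by the natural numbers.\<close>

definition is_cochain_homotopy ::
  "('o, 'm) groupoid \<Rightarrow> (nat \<Rightarrow> ('o, 'm, 'u::real_vector) gmodule) \<Rightarrow> (nat \<Rightarrow> ('o, 'u) fam) \<Rightarrow>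
    (nat \<Rightarrow> ('o, 'u) fam) \<Rightarrow>
    (nat \<Rightarrow> ('o, 'u) fam) \<Rightarrow> (nat \<Rightarrow> ('o, 'u) fam) \<Rightarrow> (nat \<Rightarrow> ('o, 'u) fam) \<Rightarrow> bool" where
  "is_cochain_homotopy G C dC dI F E h \<longleftrightarrow>
     fam_eq G (C 0) (F 0 \<ominus>\<^sub>f E 0) (h 0 \<odot> dC 0) \<and>
     (\<forall>n. fam_eq G (C (Suc n)) (F (Suc n) \<ominus>\<^sub>f E (Suc n))
            ((dI n \<odot> h n) \<oplus>\<^sub>f (h (Suc n) \<odot> dC (Suc n))))"

definition ga_homotopic ::
  "('o, 'm, 'p, 'q) gpair \<Rightarrow> ('o, 'm, 'p, 'q, 'u::real_vector) ga_complex \<Rightarrow>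
    ('o, 'm, 'p, 'q, 'u) ga_complex \<Rightarrow> (nat \<Rightarrow> ('o, 'u) fam) \<Rightarrow> (nat \<Rightarrow> ('p, 'u) fam) \<Rightarrow>
    (nat \<Rightarrow> ('o, 'u) fam) \<Rightarrow> (nat \<Rightarrow> ('p, 'u) fam) \<Rightarrow> bool" where
  "ga_homotopic P K L F F' E E' \<longleftrightarrow>
     (\<exists>h h'. (\<forall>n. is_ga_map P (cx_deg K (Suc n)) (cx_deg L n) (h n) (h' n)) \<and>
        is_cochain_homotopy (grpG P) (cxG K) (dG K) (dG L) F E h \<and>
        is_cochain_homotopy (grpA P) (cxA K) (dA K) (dA L) F' E' h')"

end

theory Submission
  imports Defs
begin

text \<open>
  As in homological algebra, extensions and homotopies are built degree by degree, each step
  extending along a coboundary \<open>d\<close> a map \<open>\<alpha>\<close> that vanishes on \<open>ker d\<close>.  By exactness the image of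
  \<open>d\<close> is the kernel \<open>Z\<close> of the next coboundary, which is a closed submodule, and \<open>\<alpha> \<odot> s\<close> (with
  \<open>s\<close> the contraction) is an equivariant map on \<open>Z\<close>.  It extends to the ambient module by relative
  injectivity, because \<open>d \<odot> s\<close> is a retraction onto \<open>Z\<close>, of norm at most \<open>1\<close> after rescaling.
\<close>

section \<open>Bounded families of maps\<close>

text \<open>For the extension, \<open>\<alpha>\<close> is \<open>\<epsilon> \<odot> f\<close> at the
  bottom and then the coboundary after \<open>F n\<close>; for a homotopy between \<open>F\<close>
  and \<open>E\<close> it is \<open>F 0 - E 0\<close> and then \<open>F (n+1) - E (n+1)\<close>
  minus the coboundary after \<open>h n\<close>. Above the bottom, the cochain identities only give
  that \<open>\<alpha>\<close> kills the image of the preceding coboundary; the contraction turns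
  this into vanishing on \<open>ker d\<close>. At the bottom, \<open>ker \<nu>\<close> is zero. The
  obstacle is that contractions are not equivariant. On \<open>Z\<close>, however,
  \<open>\<alpha> \<odot> s\<close> is the value of \<open>\<alpha>\<close> at any preimage under
  \<open>d\<close>, independently of the preimage, and this description is equivariant. Describing
  \<open>Z\<close> as a kernel gives its completeness directly, as a test module must be Banach.
  Rescaling is forced because \<open>d\<close> is bounded by an arbitrary constant, while a
  retraction is required to have norm at most 1. The two components of a pair are extended by a
  single appeal to relative injectivity: extensions chosen separately need not commute with the
  connecting maps.\<close>

definition bounded_fam ::
  "('o, 'm) groupoid \<Rightarrow> ('o, 'm, 'u) gmodule \<Rightarrow> ('o, 'm, 'u) gmodule \<Rightarrow> ('o, 'u) fam \<Rightarrow> bool" where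
  "bounded_fam G V W f \<longleftrightarrow>
     (\<exists>c\<ge>0. \<forall>e\<in>Ob G. \<forall>x\<in>fib V e. nrm W e (f e x) \<le> c * nrm V e x)"

lemma sup_norm_le:
  assumes "\<And>e x. e \<in> Ob G \<Longrightarrow> x \<in> fib V e \<Longrightarrow> nrm W e (f e x) \<le> c * nrm V e x" "c \<ge> 0"
  shows "sup_norm G V W f \<le> ennreal c"
  unfolding sup_norm_def op_norm_on_def
proof (intro SUP_least ennreal_leI)
  fix e x assume "e \<in> Ob G" and x: "x \<in> {x \<in> fib V e. nrm V e x \<le> 1}"
  then have "nrm W e (f e x) \<le> c * nrm V e x" using assms(1) by auto
  also have "\<dots> \<le> c * 1" using x assms(2) by (intro mult_left_mono) auto
  finally show "nrm W e (f e x) \<le> c" by simp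
qed

lemma linear_map_on_zero: "linear_map_on S T f \<Longrightarrow> subspace S \<Longrightarrow> f 0 = 0"
  unfolding linear_map_on_def by (metis scale_zero_left subspace_0)

lemma linear_map_on_diff:
  assumes "linear_map_on S T f" "subspace S" "x \<in> S" "y \<in> S"
  shows "f (x - y) = f x - f y"
proof -
  have "f ((x - y) + y) = f (x - y) + f y"
    using assms by (simp only: linear_map_on_def subspace_diff)
  then show ?thesis by simp
qed

lemma normed_space_on_minus:
  assumes "normed_space_on S N" "x \<in> S"
  shows "N (- x) = N x"
proof -
  have "N ((-1) *\<^sub>R x) = \<bar>-1\<bar> * N x"
    using assms by (simp only: normed_space_on_def)
  then show ?thesis by simp
qed

lemma normed_space_on_diff_le:
  assumes "normed_space_on S N" "x \<in> S" "y \<in> S"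
  shows "N (x - y) \<le> N x + N y"
proof -
  have "- y \<in> S"
    using assms by (auto simp: normed_space_on_def intro: subspace_neg)
  then have "N (x + - y) \<le> N x + N (- y)"
    using assms by (simp only: normed_space_on_def)
  with assms show ?thesis by (simp add: normed_space_on_minus)
qed

lemma normed_module_fib: "normed_module G V \<Longrightarrow> e \<in> Ob G \<Longrightarrow> normed_space_on (fib V e) (nrm V e)"
  by (simp add: normed_module_def)

text \<open>The sup norm itself serves as the constant: for nonzero \<open>x\<close>, homogeneity
  reduces the estimate to the unit vector \<open>y\<close>, where it is an instance of the
  supremum.\<close>

lemma bounded_famI_sup_norm:
  assumes V: "normed_module G V" and W: "normed_module G W"
    and lin: "\<And>e. e \<in> Ob G \<Longrightarrow> linear_map_on (fib V e) (fib W e) (f e)"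
    and fin: "sup_norm G V W f < \<infinity>"
  shows "bounded_fam G V W f"
proof -
  define c where "c = enn2real (sup_norm G V W f)"
  have "nrm W e (f e x) \<le> c * nrm V e x" if e: "e \<in> Ob G" and x: "x \<in> fib V e" for e x
  proof (cases "x = 0")
    case True
    have nV: "normed_space_on (fib V e) (nrm V e)" and nW: "normed_space_on (fib W e) (nrm W e)"
      using V W e by (auto intro: normed_module_fib)
    have "f e 0 = 0"
      using nV linear_map_on_zero[OF lin[OF e]] by (simp add: normed_space_on_def)
    with True nV nW show ?thesis
      by (metis mult_zero_right normed_space_on_def order_refl subspace_0)
  next
    case False
    have nV: "normed_space_on (fib V e) (nrm V e)" and nW: "normed_space_on (fib W e) (nrm W e)"
      using V W e by (auto intro: normed_module_fib)
    define r where "r = nrm V e x"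
    have r: "r > 0" using nV x False unfolding normed_space_on_def r_def by force
    define y where "y = (1 / r) *\<^sub>R x"
    have y: "y \<in> fib V e" using nV x by (simp add: normed_space_on_def y_def subspace_scale)
    have "nrm V e y = 1" using nV x r False by (simp add: normed_space_on_def y_def r_def)
    then have "ennreal (nrm W e (f e y)) \<le> op_norm_on (fib V e) (nrm V e) (nrm W e) (f e)"
      unfolding op_norm_on_def using y by (intro SUP_upper) auto
    also have "\<dots> \<le> sup_norm G V W f" unfolding sup_norm_def using e by (intro SUP_upper)
    also have "\<dots> = ennreal c" using fin by (simp add: c_def)
    finally have "nrm W e (f e y) \<le> c" by (simp add: c_def)
    moreover have "nrm W e (f e y) = (1 / r) * nrm W e (f e x)"
      using lin[OF e] nW x r by (simp add: linear_map_on_def normed_space_on_def y_def)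
    ultimately show ?thesis using r by (simp add: field_simps flip: r_def)
  qed
  then show ?thesis unfolding bounded_fam_def c_def by (intro exI[of _ c]) (auto simp: c_def)
qed

text \<open>Trades the supremum in \<open>ennreal\<close> for one real constant valid at all
  objects, the form in which composites, differences and rescalings are estimated.\<close>

lemma is_morphism_iff:
  assumes "normed_module G V" "normed_module G W"
  shows "is_morphism G V W f \<longleftrightarrow>
    (\<forall>e\<in>Ob G. linear_map_on (fib V e) (fib W e) (f e)) \<and> bounded_fam G V W f"
proof -
  have "sup_norm G V W f < \<infinity>" if "bounded_fam G V W f"
  proof -
    from that obtain c where
      "c \<ge> 0" "\<And>e x. e \<in> Ob G \<Longrightarrow> x \<in> fib V e \<Longrightarrow> nrm W e (f e x) \<le> c * nrm V e x"
      unfolding bounded_fam_def by auto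
    then have "sup_norm G V W f \<le> ennreal c" by (intro sup_norm_le)
    also have "\<dots> < \<infinity>" by simp
    finally show ?thesis .
  qed
  then show ?thesis
    unfolding is_morphism_def using bounded_famI_sup_norm[OF assms] by auto
qed

section \<open>Composites and differences of morphisms and equivariant maps\<close>

lemma is_morphism_mem:
  assumes "is_morphism G V W f" "e \<in> Ob G" "x \<in> fib V e"
  shows "f e x \<in> fib W e"
  using assms unfolding is_morphism_def linear_map_on_def by auto

lemma is_gmapD:
  assumes "is_gmap G V W f"
  shows is_gmap_morphism: "is_morphism G V W f"
    and is_gmap_mem: "e \<in> Ob G \<Longrightarrow> x \<in> fib V e \<Longrightarrow> f e x \<in> fib W e"
    and is_gmap_act: "g \<in> Mor G \<Longrightarrow> v \<in> fib V (src G g) \<Longrightarrow>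
      f (tgt G g) (act V g v) = act W g (f (src G g) v)"
  using assms unfolding is_gmap_def by (auto intro: is_morphism_mem)

lemma is_morphism_diff:
  assumes "is_morphism G V W f" "normed_module G V" "e \<in> Ob G" "x \<in> fib V e" "y \<in> fib V e"
  shows "f e (x - y) = f e x - f e y"
  using assms linear_map_on_diff[of "fib V e" "fib W e" "f e"]
  by (simp add: normed_module_def normed_space_on_def is_morphism_def)

lemma is_morphism_0:
  assumes "is_morphism G V W f" "normed_module G V" "e \<in> Ob G"
  shows "f e 0 = 0"
  using assms linear_map_on_zero[of "fib V e" "fib W e" "f e"]
  by (simp add: normed_module_def normed_space_on_def is_morphism_def)

lemma bounded_fam_comp:
  assumes "bounded_fam G V W f" "bounded_fam G W X g"
    and mem: "\<And>e x. e \<in> Ob G \<Longrightarrow> x \<in> fib V e \<Longrightarrow> f e x \<in> fib W e"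
  shows "bounded_fam G V X (g \<odot> f)"
proof -
  obtain b where b: "b \<ge> 0" "\<And>e x. e \<in> Ob G \<Longrightarrow> x \<in> fib V e \<Longrightarrow> nrm W e (f e x) \<le> b * nrm V e x"
    using assms(1) unfolding bounded_fam_def by auto
  obtain c where c: "c \<ge> 0" "\<And>e x. e \<in> Ob G \<Longrightarrow> x \<in> fib W e \<Longrightarrow> nrm X e (g e x) \<le> c * nrm W e x"
    using assms(2) unfolding bounded_fam_def by auto
  have "nrm X e (g e (f e x)) \<le> (c * b) * nrm V e x" if "e \<in> Ob G" "x \<in> fib V e" for e x
    using order.trans[OF c(2)[OF that(1) mem[OF that]] mult_left_mono[OF b(2)[OF that] c(1)]]
    by (simp add: mult.assoc)
  with b(1) c(1) show ?thesis
    unfolding bounded_fam_def fam_comp_def by (intro exI[of _ "c * b"]) simp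
qed

lemma is_morphism_comp:
  assumes "normed_module G V" "normed_module G W" "normed_module G X"
    and f: "is_morphism G V W f" and g: "is_morphism G W X g"
  shows "is_morphism G V X (g \<odot> f)"
proof -
  have "bounded_fam G V X (g \<odot> f)"
    using assms is_morphism_mem[OF f]
    by (intro bounded_fam_comp[of G V W]) (simp_all add: is_morphism_iff)
  moreover have "\<forall>e\<in>Ob G. linear_map_on (fib V e) (fib X e) ((g \<odot> f) e)"
    using f g unfolding is_morphism_def linear_map_on_def fam_comp_def by simp
  ultimately show ?thesis using assms by (simp add: is_morphism_iff)
qed

lemma is_gmap_comp:
  assumes "is_groupoid G" "normed_module G V" "normed_module G W" "normed_module G X"
    and f: "is_gmap G V W f" and g: "is_gmap G W X g"
  shows "is_gmap G V X (g \<odot> f)"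
  unfolding is_gmap_def
proof (intro conjI ballI)
  show "is_morphism G V X (g \<odot> f)"
    using assms by (intro is_morphism_comp[of G V W]) (auto intro: is_gmap_morphism)
next
  fix a v assume a: "a \<in> Mor G" "v \<in> fib V (src G a)"
  then have "src G a \<in> Ob G" using assms(1) by (simp add: is_groupoid_def)
  then show "(g \<odot> f) (tgt G a) (act V a v) = act X a ((g \<odot> f) (src G a) v)"
    using a is_gmap_act[OF f] is_gmap_act[OF g] is_gmap_mem[OF f] by (simp add: fam_comp_def)
qed

lemma bounded_fam_diff:
  assumes "bounded_fam G V W f" "bounded_fam G V W g" "normed_module G W"
    and mem: "\<And>e x. e \<in> Ob G \<Longrightarrow> x \<in> fib V e \<Longrightarrow> f e x \<in> fib W e \<and> g e x \<in> fib W e"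
  shows "bounded_fam G V W (f \<ominus>\<^sub>f g)"
proof -
  obtain b where b: "b \<ge> 0" "\<And>e x. e \<in> Ob G \<Longrightarrow> x \<in> fib V e \<Longrightarrow> nrm W e (f e x) \<le> b * nrm V e x"
    using assms(1) unfolding bounded_fam_def by auto
  obtain c where c: "c \<ge> 0" "\<And>e x. e \<in> Ob G \<Longrightarrow> x \<in> fib V e \<Longrightarrow> nrm W e (g e x) \<le> c * nrm V e x"
    using assms(2) unfolding bounded_fam_def by auto
  have "nrm W e (f e x - g e x) \<le> (b + c) * nrm V e x" if e: "e \<in> Ob G" "x \<in> fib V e" for e x
  proof -
    have n: "normed_space_on (fib W e) (nrm W e)" using assms(3) e by (auto intro: normed_module_fib)
    have m: "f e x \<in> fib W e" "g e x \<in> fib W e" using mem[OF e] by auto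
    have "nrm W e (f e x - g e x) \<le> nrm W e (f e x) + nrm W e (g e x)"
      using n m by (rule normed_space_on_diff_le)
    then show ?thesis using b(2)[OF e] c(2)[OF e] by (simp add: algebra_simps)
  qed
  with b(1) c(1) show ?thesis
    unfolding bounded_fam_def fam_diff_def by (intro exI[of _ "b + c"]) simp
qed

lemma is_gmap_diff:
  assumes "is_groupoid G" "normed_module G V" "normed_module G W"
    and f: "is_gmap G V W f" and g: "is_gmap G V W g"
  shows "is_gmap G V W (f \<ominus>\<^sub>f g)"
  unfolding is_gmap_def
proof (intro conjI ballI)
  have "bounded_fam G V W (f \<ominus>\<^sub>f g)"
    using assms by (intro bounded_fam_diff)
      (auto simp: is_morphism_iff dest: is_gmap_morphism is_gmap_mem)
  moreover have "linear_map_on (fib V e) (fib W e) ((f \<ominus>\<^sub>f g) e)" if e: "e \<in> Ob G" for e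
  proof -
    have "subspace (fib W e)"
      using assms(3) e by (simp add: normed_module_def normed_space_on_def)
    then show ?thesis
      using e f g unfolding is_gmap_def is_morphism_def linear_map_on_def fam_diff_def
      by (simp add: subspace_diff scaleR_diff_right)
  qed
  ultimately show "is_morphism G V W (f \<ominus>\<^sub>f g)" using assms by (simp add: is_morphism_iff)
next
  fix a v assume a: "a \<in> Mor G" "v \<in> fib V (src G a)"
  have s: "src G a \<in> Ob G" using assms(1) a by (simp add: is_groupoid_def)
  have "linear_map_on (fib W (src G a)) (fib W (tgt G a)) (act W a)"
    "subspace (fib W (src G a))"
    using assms(3) a s by (auto simp: normed_module_def normed_space_on_def)
  then have "act W a (f (src G a) v - g (src G a) v)
      = act W a (f (src G a) v) - act W a (g (src G a) v)"
    using is_gmap_mem[OF f s a(2)] is_gmap_mem[OF g s a(2)] by (intro linear_map_on_diff)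
  then show "(f \<ominus>\<^sub>f g) (tgt G a) (act V a v) = act W a ((f \<ominus>\<^sub>f g) (src G a) v)"
    using a is_gmap_act[OF f] is_gmap_act[OF g] by (simp add: fam_diff_def)
qed


section \<open>Rescaled modules, kernels and pullbacks\<close>

text \<open>Fibres and action are left alone, so one and the same family is a map of the original
  and of the rescaled module, and nothing has to be transported.\<close>

definition scale_module :: "real \<Rightarrow> ('o, 'm, 'u) gmodule \<Rightarrow> ('o, 'm, 'u) gmodule" where
  "scale_module c V = V\<lparr>nrm := \<lambda>e x. c * nrm V e x\<rparr>"

lemma scale_module_simps [simp]:
  "fib (scale_module c V) = fib V"
  "nrm (scale_module c V) = (\<lambda>e x. c * nrm V e x)"
  "act (scale_module c V) = act V"
  by (simp_all add: scale_module_def)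

lemma banach_module_normed: "banach_module G V \<Longrightarrow> normed_module G V"
  by (simp add: banach_module_def)

lemma normed_module_scale:
  assumes c: "c > 0" and V: "normed_module G V"
  shows "normed_module G (scale_module c V)"
proof -
  have "normed_space_on (fib V e) (\<lambda>x. c * nrm V e x)" if "e \<in> Ob G" for e
    using normed_module_fib[OF V that] c
    by (simp add: normed_space_on_def mult.left_commute flip: distrib_left)
  with V show ?thesis by (simp add: normed_module_def)
qed

lemma banach_module_scale:
  assumes c: "c > 0" and V: "banach_module G V"
  shows "banach_module G (scale_module c V)"
proof -
  have "complete_norm_on (fib V e) (\<lambda>x. c * nrm V e x)" if e: "e \<in> Ob G" for e
    unfolding complete_norm_on_def
  proof (intro allI impI, elim conjE)
    fix X :: "nat \<Rightarrow> _"
    assume X: "\<forall>n. X n \<in> fib V e"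
      and Cau: "\<forall>\<epsilon>>0. \<exists>M. \<forall>m\<ge>M. \<forall>n\<ge>M. c * nrm V e (X m - X n) < \<epsilon>"
    have "\<exists>M. \<forall>m\<ge>M. \<forall>n\<ge>M. nrm V e (X m - X n) < \<epsilon>" if "\<epsilon> > 0" for \<epsilon>
      using Cau[rule_format, of "c * \<epsilon>"] that c by simp
    with X V e obtain x where "x \<in> fib V e" "(\<lambda>n. nrm V e (X n - x)) \<longlonglongrightarrow> 0"
      unfolding banach_module_def complete_norm_on_def by blast
    then show "\<exists>x\<in>fib V e. (\<lambda>n. c * nrm V e (X n - x)) \<longlonglongrightarrow> 0"
      by (intro bexI[of _ x] tendsto_mult_right_zero)
  qed
  with normed_module_scale[OF c banach_module_normed[OF V]] show ?thesis
    by (simp add: banach_module_def)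
qed

lemma bounded_fam_scale:
  assumes "b > 0" "c > 0"
  shows "bounded_fam G (scale_module b V) (scale_module c W) f \<longleftrightarrow> bounded_fam G V W f"
    (is "?L \<longleftrightarrow> ?R")
proof
  assume ?L
  then obtain r where "r \<ge> 0"
    "\<forall>e\<in>Ob G. \<forall>x\<in>fib V e. c * nrm W e (f e x) \<le> r * (b * nrm V e x)"
    unfolding bounded_fam_def by auto
  with assms show ?R
    unfolding bounded_fam_def by (intro exI[of _ "r * b / c"]) (auto simp: field_simps)
next
  assume ?R
  then obtain r where "r \<ge> 0"
    "\<forall>e\<in>Ob G. \<forall>x\<in>fib V e. nrm W e (f e x) \<le> r * nrm V e x"
    unfolding bounded_fam_def by auto
  with assms show ?L
    unfolding bounded_fam_def by (intro exI[of _ "c * r / b"]) (auto simp: field_simps)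
qed

lemma is_morphism_scale_iff:
  assumes "b > 0" "c > 0" "normed_module G V" "normed_module G W"
  shows "is_morphism G (scale_module b V) (scale_module c W) f \<longleftrightarrow> is_morphism G V W f"
  unfolding is_morphism_iff[OF assms(3,4)]
    is_morphism_iff[OF normed_module_scale[OF assms(1,3)] normed_module_scale[OF assms(2,4)]]
    bounded_fam_scale[OF assms(1,2)] scale_module_simps ..

lemma is_gmap_scale_iff:
  assumes "b > 0" "c > 0" "normed_module G V" "normed_module G W"
  shows "is_gmap G (scale_module b V) (scale_module c W) f \<longleftrightarrow> is_gmap G V W f"
  unfolding is_gmap_def is_morphism_scale_iff[OF assms] scale_module_simps ..

text \<open>Instantiating one factor of the preceding equivalences with 1 rescales only the source
  or only the target.\<close>

lemma scale_module_1 [simp]: "scale_module 1 V = V"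
  by (simp add: scale_module_def)

section \<open>Kernels of equivariant maps\<close>

text \<open>Norm and action stay the ambient functions, since only their values on the fibres
  matter; the inclusion of the kernel is then simply \<open>fam_id\<close>.\<close>

definition kernel_module ::
  "('o, 'm, 'u::real_vector) gmodule \<Rightarrow> ('o, 'u) fam \<Rightarrow> ('o, 'm, 'u) gmodule" where
  "kernel_module V f = V\<lparr>fib := \<lambda>e. {x \<in> fib V e. f e x = 0}\<rparr>"

lemma kernel_module_simps [simp]:
  "fib (kernel_module V f) = (\<lambda>e. {x \<in> fib V e. f e x = 0})"
  "nrm (kernel_module V f) = nrm V"
  "act (kernel_module V f) = act V"
  by (simp_all add: kernel_module_def)

lemma subspace_kernel:
  assumes "linear_map_on S T f" "subspace S"
  shows "subspace {x \<in> S. f x = 0}"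
  using assms linear_map_on_zero[OF assms]
  by (auto simp: subspace_def linear_map_on_def)

lemma normed_module_kernel:
  assumes G: "is_groupoid G" and V: "normed_module G V" and W: "normed_module G W"
    and f: "is_gmap G V W f"
  shows "normed_module G (kernel_module V f)"
proof -
  have "normed_space_on {x \<in> fib V e. f e x = 0} (nrm V e)" if e: "e \<in> Ob G" for e
    using normed_module_fib[OF V e] subspace_kernel[of "fib V e" "fib W e" "f e"] f e
    by (auto simp: normed_space_on_def is_gmap_def is_morphism_def)
  \<comment> \<open>The kernel is stable under the action: by equivariance \<open>f\<close> sends
    \<open>g v\<close> to the image of \<open>f v = 0\<close> under the linear action of
    \<open>g\<close>.\<close>
  moreover have "f (tgt G g) (act V g v) = 0"
    if g: "g \<in> Mor G" and v: "v \<in> fib V (src G g)" and z: "f (src G g) v = 0" for g v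
  proof -
    have "linear_map_on (fib W (src G g)) (fib W (tgt G g)) (act W g)" "subspace (fib W (src G g))"
      using W g G by (auto simp: normed_module_def normed_space_on_def is_groupoid_def)
    then show ?thesis using is_gmap_act[OF f g v] z by (simp add: linear_map_on_zero)
  qed
  ultimately show ?thesis
    using V by (simp add: normed_module_def linear_map_on_def)
qed

text \<open>Boundedness gives closedness: if \<open>X n\<close> lies in the kernel and tends to
  \<open>x\<close>, then the norm of \<open>f x\<close> equals that of \<open>f (X n - x)\<close>,
  at most \<open>c\<close> times the norm of \<open>X n - x\<close>, which tends to 0.\<close>

lemma banach_module_kernel:
  assumes G: "is_groupoid G" and V: "banach_module G V" and W: "normed_module G W"
    and f: "is_gmap G V W f"
  shows "banach_module G (kernel_module V f)"
proof -
  note nV = banach_module_normed[OF V]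
  have mor: "is_morphism G V W f" using f by (rule is_gmap_morphism)
  obtain c where c: "c \<ge> 0" "\<And>e x. e \<in> Ob G \<Longrightarrow> x \<in> fib V e \<Longrightarrow> nrm W e (f e x) \<le> c * nrm V e x"
    using mor nV W unfolding is_morphism_iff[OF nV W] bounded_fam_def by auto
  have "complete_norm_on {x \<in> fib V e. f e x = 0} (nrm V e)" if e: "e \<in> Ob G" for e
    unfolding complete_norm_on_def
  proof (intro allI impI, elim conjE)
    fix X :: "nat \<Rightarrow> _"
    assume X: "\<forall>n. X n \<in> {x \<in> fib V e. f e x = 0}"
      and "\<forall>\<epsilon>>0. \<exists>M. \<forall>m\<ge>M. \<forall>n\<ge>M. nrm V e (X m - X n) < \<epsilon>"
    with V e obtain x where x: "x \<in> fib V e" "(\<lambda>n. nrm V e (X n - x)) \<longlonglongrightarrow> 0"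
      unfolding banach_module_def complete_norm_on_def by blast
    have sub: "subspace (fib V e)" using nV e by (simp add: normed_module_def normed_space_on_def)
    have nW: "normed_space_on (fib W e) (nrm W e)" using W e by (rule normed_module_fib)
    have fx: "f e x \<in> fib W e" using is_gmap_mem[OF f e x(1)] .
    have "nrm W e (f e x) \<le> c * nrm V e (X n - x)" for n
    proof -
      have "f e (X n - x) = - f e x" using X x(1) is_morphism_diff[OF mor nV e] by simp
      moreover have "nrm W e (- f e x) = nrm W e (f e x)"
        using nW fx by (rule normed_space_on_minus)
      ultimately show ?thesis using c(2)[OF e, of "X n - x"] X x(1) sub by (simp add: subspace_diff)
    qed
    then have "nrm W e (f e x) \<le> 0"
      using x(2) by (intro LIMSEQ_le_const[OF tendsto_mult_right_zero[of _ _ c]]) auto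
    then have "f e x = 0" using nW fx unfolding normed_space_on_def by (meson order_antisym)
    with x show "\<exists>x\<in>{x \<in> fib V e. f e x = 0}. (\<lambda>n. nrm V e (X n - x)) \<longlonglongrightarrow> 0" by auto
  qed
  with normed_module_kernel[OF G nV W f] show ?thesis by (simp add: banach_module_def)
qed

section \<open>Pullback along a pair of groupoids\<close>

lemma normed_module_pull:
  assumes P: "is_groupoid_pair P" and V: "normed_module (grpG P) V"
  shows "normed_module (grpA P) (pull_module P V)"
proof -
  have F: "is_groupoid_functor (grpA P) (grpG P) (iOb P) (iMor P)"
    using P by (simp add: is_groupoid_pair_def)
  have "linear_map_on (fib V (iOb P (src (grpA P) a))) (fib V (iOb P (tgt (grpA P) a))) (act V (iMor P a)) \<and>
      (\<forall>v\<in>fib V (iOb P (src (grpA P) a)).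
        nrm V (iOb P (tgt (grpA P) a)) (act V (iMor P a) v) = nrm V (iOb P (src (grpA P) a)) v)"
    if a: "a \<in> Mor (grpA P)" for a
  proof -
    have "iMor P a \<in> Mor (grpG P)" and eq: "src (grpG P) (iMor P a) = iOb P (src (grpA P) a)"
      "tgt (grpG P) (iMor P a) = iOb P (tgt (grpA P) a)"
      using F a by (auto simp: is_groupoid_functor_def)
    \<comment> \<open>The fibres are rewritten as those at the source and target of
      \<open>iMor P a\<close>, the form in which the module axioms of \<open>V\<close> speak of
      them.\<close>
    then show ?thesis using V unfolding normed_module_def eq[symmetric] by blast
  qed
  with F V show ?thesis
    unfolding is_groupoid_functor_def normed_module_def pull_module_def by simp
qed

lemma pull_module_simps [simp]:
  "fib (pull_module P V) = (\<lambda>a. fib V (iOb P a))"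
  "nrm (pull_module P V) = (\<lambda>a. nrm V (iOb P a))"
  "act (pull_module P V) = (\<lambda>a. act V (iMor P a))"
  by (simp_all add: pull_module_def)

lemma pull_scale_module: "pull_module P (scale_module c V) = scale_module c (pull_module P V)"
  by (simp add: pull_module_def scale_module_def)

lemma pull_kernel_module:
  "pull_module P (kernel_module V f) = kernel_module (pull_module P V) (pull_fam P f)"
  by (simp add: pull_module_def kernel_module_def pull_fam_def)

lemma banach_module_pull:
  assumes P: "is_groupoid_pair P" and V: "banach_module (grpG P) V"
  shows "banach_module (grpA P) (pull_module P V)"
  using normed_module_pull[OF P banach_module_normed[OF V]] P V
  by (simp add: banach_module_def is_groupoid_pair_def is_groupoid_functor_def)

section \<open>Restricting and corestricting maps to kernels\<close>

lemma sup_norm_kernel_left: "sup_norm G (kernel_module V p) W f \<le> sup_norm G V W f"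
  unfolding sup_norm_def op_norm_on_def by (intro SUP_mono' SUP_subset_mono) auto

lemma is_morphism_restrict_kernel:
  "is_morphism G V W f \<Longrightarrow> is_morphism G (kernel_module V p) W f"
  using sup_norm_kernel_left[of G V p W f]
  by (auto simp: is_morphism_def linear_map_on_def intro: order.strict_trans1)

lemma is_morphism_corestrict_kernel:
  assumes "is_morphism G V W f" "\<And>e x. e \<in> Ob G \<Longrightarrow> x \<in> fib V e \<Longrightarrow> q e (f e x) = 0"
  shows "is_morphism G V (kernel_module W q) f"
  using assms by (simp add: is_morphism_def linear_map_on_def sup_norm_def)

lemma is_gmap_kernel:
  assumes "is_gmap G V W f"
    and "\<And>e x. e \<in> Ob G \<Longrightarrow> x \<in> fib V e \<Longrightarrow> p e x = 0 \<Longrightarrow> q e (f e x) = 0"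
  shows "is_gmap G (kernel_module V p) (kernel_module W q) f"
proof -
  have "is_morphism G (kernel_module V p) (kernel_module W q) f"
    using assms
    by (intro is_morphism_corestrict_kernel is_morphism_restrict_kernel) (auto simp: is_gmap_def)
  with assms(1) show ?thesis by (simp add: is_gmap_def)
qed

lemma is_gmap_restrict_kernel: "is_gmap G V W f \<Longrightarrow> is_gmap G (kernel_module V p) W f"
  by (simp add: is_gmap_def is_morphism_restrict_kernel)

lemma is_gmap_id: "normed_module G V \<Longrightarrow> is_gmap G V V fam_id"
  unfolding is_gmap_def
  by (auto simp: is_morphism_iff linear_map_on_def fam_id_def bounded_fam_def intro!: exI[of _ 1])


section \<open>Modules over a pair\<close>

lemma is_groupoid_pairD:
  assumes "is_groupoid_pair P"
  shows "is_groupoid (grpG P)" "is_groupoid (grpA P)"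
    "a \<in> Ob (grpA P) \<Longrightarrow> iOb P a \<in> Ob (grpG P)"
  using assms by (auto simp: is_groupoid_pair_def is_groupoid_functor_def)

lemma is_ga_moduleD:
  assumes "is_ga_module P M"
  shows "banach_module (grpG P) (modG M)" "banach_module (grpA P) (modA M)"
    "normed_module (grpG P) (modG M)" "normed_module (grpA P) (modA M)"
    "is_gmap (grpA P) (pull_module P (modG M)) (modA M) (conn M)"
  using assms by (auto simp: is_ga_module_def banach_module_def)

lemma ga_compatible_iff:
  "ga_compatible P M N j j' \<longleftrightarrow> (\<forall>a\<in>Ob (grpA P). \<forall>x\<in>fib (modG M) (iOb P a).
     conn N a (j (iOb P a) x) = j' a (conn M a x))"
  by (simp add: ga_compatible_def fam_eq_def fam_comp_def pull_fam_def)

lemma is_ga_morphism_comp: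
  assumes P: "is_groupoid_pair P"
    and "is_ga_module P M" "is_ga_module P N" "is_ga_module P K"
    and j: "is_ga_morphism P M N j j'" and k: "is_ga_morphism P N K k k'"
  shows "is_ga_morphism P M K (k \<odot> j) (k' \<odot> j')"
proof -
  have "is_morphism (grpG P) (modG M) (modG K) (k \<odot> j)"
    "is_morphism (grpA P) (modA M) (modA K) (k' \<odot> j')"
    using assms is_ga_moduleD by (auto simp: is_ga_morphism_def intro!: is_morphism_comp[rotated 3])
  moreover have "ga_compatible P M K (k \<odot> j) (k' \<odot> j')"
    unfolding ga_compatible_iff
  proof (intro ballI)
    fix a x assume a: "a \<in> Ob (grpA P)" and x: "x \<in> fib (modG M) (iOb P a)"
    have "j (iOb P a) x \<in> fib (modG N) (iOb P a)"
      using j is_groupoid_pairD(3)[OF P a] x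
      by (auto simp: is_ga_morphism_def intro: is_morphism_mem)
    then show "conn K a ((k \<odot> j) (iOb P a) x) = (k' \<odot> j') a (conn M a x)"
      using j k a x by (simp add: is_ga_morphism_def ga_compatible_iff fam_comp_def)
  qed
  ultimately show ?thesis by (simp add: is_ga_morphism_def)
qed

lemma is_ga_map_imp_morphism: "is_ga_map P M N j j' \<Longrightarrow> is_ga_morphism P M N j j'"
  by (simp add: is_ga_map_def is_ga_morphism_def is_gmap_def)

lemma is_ga_map_comp:
  assumes P: "is_groupoid_pair P"
    and M: "is_ga_module P M" "is_ga_module P N" "is_ga_module P K"
    and j: "is_ga_map P M N j j'" and k: "is_ga_map P N K k k'"
  shows "is_ga_map P M K (k \<odot> j) (k' \<odot> j')"
proof -
  have "is_gmap (grpG P) (modG M) (modG K) (k \<odot> j)"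
    using j k by (intro is_gmap_comp[OF is_groupoid_pairD(1)[OF P] is_ga_moduleD(3)[OF M(1)]
          is_ga_moduleD(3)[OF M(2)] is_ga_moduleD(3)[OF M(3)]]) (simp_all add: is_ga_map_def)
  moreover have "is_gmap (grpA P) (modA M) (modA K) (k' \<odot> j')"
    using j k by (intro is_gmap_comp[OF is_groupoid_pairD(2)[OF P] is_ga_moduleD(4)[OF M(1)]
          is_ga_moduleD(4)[OF M(2)] is_ga_moduleD(4)[OF M(3)]]) (simp_all add: is_ga_map_def)
  moreover have "ga_compatible P M K (k \<odot> j) (k' \<odot> j')"
    using is_ga_morphism_comp[OF P M j[THEN is_ga_map_imp_morphism] k[THEN is_ga_map_imp_morphism]]
    by (simp add: is_ga_morphism_def)
  ultimately show ?thesis by (simp add: is_ga_map_def)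
qed

lemma is_ga_map_diff:
  assumes P: "is_groupoid_pair P"
    and M: "is_ga_module P M" and N: "is_ga_module P N"
    and j: "is_ga_map P M N j j'" and k: "is_ga_map P M N k k'"
  shows "is_ga_map P M N (j \<ominus>\<^sub>f k) (j' \<ominus>\<^sub>f k')"
proof -
  have "ga_compatible P M N (j \<ominus>\<^sub>f k) (j' \<ominus>\<^sub>f k')"
    unfolding ga_compatible_iff
  proof (intro ballI)
    fix a x assume a: "a \<in> Ob (grpA P)" and x: "x \<in> fib (modG M) (iOb P a)"
    have i: "iOb P a \<in> Ob (grpG P)" using P a by (rule is_groupoid_pairD(3))
    have m: "j (iOb P a) x \<in> fib (modG N) (iOb P a)" "k (iOb P a) x \<in> fib (modG N) (iOb P a)"
      using j k i x by (auto simp: is_ga_map_def intro: is_gmap_mem)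
    have "conn N a (j (iOb P a) x - k (iOb P a) x) = conn N a (j (iOb P a) x) - conn N a (k (iOb P a) x)"
      using is_morphism_diff[OF is_gmap_morphism[OF is_ga_moduleD(5)[OF N]]
          normed_module_pull[OF P is_ga_moduleD(3)[OF N]] a] m by simp
    then show "conn N a ((j \<ominus>\<^sub>f k) (iOb P a) x) = (j' \<ominus>\<^sub>f k') a (conn M a x)"
      using j k a x by (simp add: is_ga_map_def ga_compatible_iff fam_diff_def)
  qed
  then show ?thesis
    using j k is_gmap_diff[OF is_groupoid_pairD(1)[OF P] is_ga_moduleD(3)[OF M] is_ga_moduleD(3)[OF N]]
      is_gmap_diff[OF is_groupoid_pairD(2)[OF P] is_ga_moduleD(4)[OF M] is_ga_moduleD(4)[OF N]]
    by (simp add: is_ga_map_def)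
qed

lemma is_ga_module_diag:
  assumes "is_groupoid_pair P" "banach_module (grpG P) V"
  shows "is_ga_module P (diag_module P V)"
  using banach_module_pull[OF assms] assms(2)
  by (simp add: is_ga_module_def diag_module_def is_gmap_id banach_module_normed)

section \<open>Kernels and rescalings of modules over a pair\<close>

definition kernel_ga_module ::
  "('o, 'm, 'p, 'q, 'u::real_vector) ga_module \<Rightarrow> ('o, 'u) fam \<Rightarrow> ('p, 'u) fam \<Rightarrow>
    ('o, 'm, 'p, 'q, 'u) ga_module" where
  "kernel_ga_module N e e' = \<lparr>modG = kernel_module (modG N) e, modA = kernel_module (modA N) e', conn = conn N\<rparr>"

text \<open>A common factor leaves the norm of the connecting map unchanged; in the application it
  is the larger of the factors demanded by the two components.\<close>

definition scale_ga_module ::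
  "real \<Rightarrow> ('o, 'm, 'p, 'q, 'u) ga_module \<Rightarrow> ('o, 'm, 'p, 'q, 'u) ga_module" where
  "scale_ga_module c N = \<lparr>modG = scale_module c (modG N), modA = scale_module c (modA N), conn = conn N\<rparr>"

lemma ga_module_construction_simps [simp]:
  "modG (kernel_ga_module N e e') = kernel_module (modG N) e"
  "modA (kernel_ga_module N e e') = kernel_module (modA N) e'"
  "conn (kernel_ga_module N e e') = conn N"
  "modG (scale_ga_module c N) = scale_module c (modG N)"
  "modA (scale_ga_module c N) = scale_module c (modA N)"
  "conn (scale_ga_module c N) = conn N"
  by (simp_all add: kernel_ga_module_def scale_ga_module_def)

text \<open>The connecting map of \<open>N\<close> restricts to the kernels because
  \<open>e' \<odot> conn N\<close> agrees with \<open>conn K \<odot> e\<close> and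
  \<open>conn K\<close> sends 0 to 0.\<close>

lemma is_ga_module_kernel:
  assumes P: "is_groupoid_pair P" and N: "is_ga_module P N" and K: "is_ga_module P K"
    and e: "is_ga_map P N K e e'"
  shows "is_ga_module P (kernel_ga_module N e e')"
proof -
  have "is_gmap (grpA P) (pull_module P (kernel_module (modG N) e)) (kernel_module (modA N) e') (conn N)"
    unfolding pull_kernel_module
  proof (rule is_gmap_kernel[OF is_ga_moduleD(5)[OF N]])
    fix a x assume a: "a \<in> Ob (grpA P)" and x: "x \<in> fib (pull_module P (modG N)) a"
      and z: "pull_fam P e a x = 0"
    have "e' a (conn N a x) = conn K a (e (iOb P a) x)"
      using e a x by (simp add: is_ga_map_def ga_compatible_iff)
    also have "\<dots> = conn K a 0" using z by (simp add: pull_fam_def)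
    also have "\<dots> = 0"
      using is_morphism_0[OF is_gmap_morphism[OF is_ga_moduleD(5)[OF K]]
          normed_module_pull[OF P is_ga_moduleD(3)[OF K]] a] .
    finally show "e' a (conn N a x) = 0" .
  qed
  moreover have "banach_module (grpG P) (kernel_module (modG N) e)"
    using e by (intro banach_module_kernel[OF is_groupoid_pairD(1)[OF P] is_ga_moduleD(1)[OF N]
          is_ga_moduleD(3)[OF K]]) (simp add: is_ga_map_def)
  moreover have "banach_module (grpA P) (kernel_module (modA N) e')"
    using e by (intro banach_module_kernel[OF is_groupoid_pairD(2)[OF P] is_ga_moduleD(2)[OF N]
          is_ga_moduleD(4)[OF K]]) (simp add: is_ga_map_def)
  ultimately show ?thesis by (simp add: is_ga_module_def)
qed

lemma is_ga_module_scale: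
  assumes P: "is_groupoid_pair P" and c: "c > 0" and N: "is_ga_module P N"
  shows "is_ga_module P (scale_ga_module c N)"
  using is_ga_moduleD[OF N] c normed_module_pull[OF P is_ga_moduleD(3)[OF N]]
  by (simp add: is_ga_module_def banach_module_scale pull_scale_module is_gmap_scale_iff)

section \<open>Extension along a contractible complex\<close>

text \<open>Multiplying the source norm by \<open>b\<close> divides the norm of \<open>f\<close> by
  \<open>b\<close>. Allowing every \<open>b\<close> above a threshold lets one factor serve both
  components of a pair.\<close>

lemma bounded_by_scale:
  assumes "normed_module G V" "normed_module G W" "is_morphism G V W f"
  obtains c where "c > 0" "\<And>b. b \<ge> c \<Longrightarrow> sup_norm G (scale_module b V) W f \<le> 1"
proof -
  obtain c where c: "c \<ge> 0" "\<And>e x. e \<in> Ob G \<Longrightarrow> x \<in> fib V e \<Longrightarrow> nrm W e (f e x) \<le> c * nrm V e x"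
    using assms by (auto simp: is_morphism_iff bounded_fam_def)
  \<comment> \<open>The added 1 keeps the threshold positive when the bound \<open>c\<close> is
    0.\<close>
  have "sup_norm G (scale_module b V) W f \<le> ennreal 1" if b: "b \<ge> c + 1" for b
  proof (rule sup_norm_le)
    fix e x assume e: "e \<in> Ob G" and x: "x \<in> fib (scale_module b V) e"
    have "0 \<le> nrm V e x"
      using normed_module_fib[OF assms(1) e] x by (simp add: normed_space_on_def)
    then have "c * nrm V e x \<le> b * nrm V e x" using b by (intro mult_right_mono) auto
    then show "nrm W e (f e x) \<le> 1 * nrm (scale_module b V) e x"
      using c(2)[OF e, of x] x by simp
  qed simp
  with c(1) show thesis by (intro that[of "c + 1"]) auto
qed

text \<open>The section \<open>s\<close> is not equivariant, but its failure to be so lies in the kernel of \<open>d\<close>,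
  which \<open>\<alpha>\<close> does not see.\<close>

lemma is_gmap_comp_section:
  assumes G: "is_groupoid G" and M: "normed_module G M" and N: "normed_module G N"
    and K: "normed_module G K" and X: "normed_module G X"
    and d: "is_gmap G M N d" and e: "is_gmap G N K e" and s: "is_morphism G N M s"
    and \<alpha>: "is_gmap G M X \<alpha>"
    and ds: "fam_eq G (kernel_module N e) (d \<odot> s) fam_id"
    and asd: "fam_eq G M ((\<alpha> \<odot> s) \<odot> d) \<alpha>"
  shows "is_gmap G (kernel_module N e) X (\<alpha> \<odot> s)"
  unfolding is_gmap_def
proof (intro conjI ballI)
  show "is_morphism G (kernel_module N e) X (\<alpha> \<odot> s)"
    using is_morphism_comp[OF N M X s is_gmap_morphism[OF \<alpha>]] by (rule is_morphism_restrict_kernel)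
next
  fix g v assume g: "g \<in> Mor G" and "v \<in> fib (kernel_module N e) (src G g)"
  then have v: "v \<in> fib N (src G g)" "e (src G g) v = 0" by auto
  have o: "src G g \<in> Ob G" "tgt G g \<in> Ob G" using G g by (auto simp: is_groupoid_def)
  \<comment> \<open>\<open>m\<close> is a preimage of \<open>v\<close> under \<open>d\<close>, so
    \<open>g v\<close> is \<open>d\<close> of \<open>g m\<close>; on the image of \<open>d\<close>,
    by \<open>asd\<close>, the map is computed by applying the equivariant \<open>\<alpha>\<close>
    to preimages.\<close>
  define m where "m = s (src G g) v"
  have m: "m \<in> fib M (src G g)" unfolding m_def using s o(1) v(1) by (rule is_morphism_mem)
  have dm: "d (src G g) m = v"
    using ds o v by (simp add: fam_eq_def fam_comp_def fam_id_def m_def)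
  have gm: "act M g m \<in> fib M (tgt G g)"
    using M g m by (simp add: normed_module_def linear_map_on_def)
  have "(\<alpha> \<odot> s) (tgt G g) (act N g v) = (\<alpha> \<odot> s) (tgt G g) (d (tgt G g) (act M g m))"
    using is_gmap_act[OF d g m] dm by simp
  also have "\<dots> = \<alpha> (tgt G g) (act M g m)"
    using asd o gm by (simp add: fam_eq_def fam_comp_def)
  also have "\<dots> = act X g ((\<alpha> \<odot> s) (src G g) v)"
    using is_gmap_act[OF \<alpha> g m] by (simp add: fam_comp_def m_def)
  finally show "(\<alpha> \<odot> s) (tgt G g) (act (kernel_module N e) g v) = act X g ((\<alpha> \<odot> s) (src G g) v)"
    by simp
qed

text \<open>This is independence of the preimage: \<open>s (d x)\<close> and \<open>x\<close> have
  the same image under \<open>d\<close>, as \<open>d x\<close> lies in the kernel of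
  \<open>e\<close> where \<open>d \<odot> s\<close> is the identity. They thus differ by an element
  of \<open>ker d\<close>, on which \<open>\<alpha>\<close> vanishes.\<close>

lemma fam_eq_comp_section:
  assumes M: "normed_module G M" and N: "normed_module G N" and X: "normed_module G X"
    and d: "is_gmap G M N d" and s: "is_morphism G N M s" and \<alpha>: "is_gmap G M X \<alpha>"
    and ed: "fam_eq G M (e \<odot> d) fam_zero"
    and ds: "fam_eq G (kernel_module N e) (d \<odot> s) fam_id"
    and ker: "fam_eq G (kernel_module M d) \<alpha> fam_zero"
  shows "fam_eq G M ((\<alpha> \<odot> s) \<odot> d) \<alpha>"
  unfolding fam_eq_def
proof (intro ballI)
  fix e0 x assume o: "e0 \<in> Ob G" and x: "x \<in> fib M e0"
  define y where "y = s e0 (d e0 x)"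
  have dx: "d e0 x \<in> fib N e0" using is_gmap_mem[OF d o x] .
  have y: "y \<in> fib M e0" unfolding y_def using s o dx by (rule is_morphism_mem)
  have sub: "subspace (fib M e0)" using M o by (simp add: normed_module_def normed_space_on_def)
  have "e e0 (d e0 x) = 0" using ed o x by (simp add: fam_eq_def fam_comp_def fam_zero_def)
  then have "d e0 y = d e0 x"
    using ds o dx by (simp add: fam_eq_def fam_comp_def fam_id_def y_def)
  then have "d e0 (y - x) = 0" using is_morphism_diff[OF is_gmap_morphism[OF d] M o y x] by simp
  then have "\<alpha> e0 (y - x) = 0"
    using ker o subspace_diff[OF sub y x] by (simp add: fam_eq_def fam_zero_def)
  then show "((\<alpha> \<odot> s) \<odot> d) e0 x = \<alpha> e0 x"
    using is_morphism_diff[OF is_gmap_morphism[OF \<alpha>] M o y x] by (simp add: fam_comp_def y_def)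
qed

text \<open>The kernel of \<open>e\<close>, which is the image of \<open>d\<close>, embeds into \<open>N\<close> with retraction \<open>d \<odot> s\<close>.
  This retraction need not have norm at most \<open>1\<close>; multiplying the norms of \<open>N\<close> by a large
  constant repairs this and affects neither equivariance nor boundedness of the extension.\<close>

lemma rel_injective_extend:
  fixes M N K X :: "('o, 'm, 'p, 'q, 'u::real_vector) ga_module"
  assumes P: "is_groupoid_pair P"
    and M: "is_ga_module P M" and N: "is_ga_module P N" and K: "is_ga_module P K"
    and X: "rel_injective_module P X"
    and d: "is_ga_map P M N d d'" and e: "is_ga_map P N K e e'" and s: "is_ga_morphism P N M s s'"
    and \<alpha>: "is_ga_map P M X \<alpha> \<alpha>'"
    and ed: "fam_eq (grpG P) (modG M) (e \<odot> d) fam_zero" "fam_eq (grpA P) (modA M) (e' \<odot> d') fam_zero"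
    and ds: "fam_eq (grpG P) (kernel_module (modG N) e) (d \<odot> s) fam_id"
      "fam_eq (grpA P) (kernel_module (modA N) e') (d' \<odot> s') fam_id"
    and ker: "fam_eq (grpG P) (kernel_module (modG M) d) \<alpha> fam_zero"
      "fam_eq (grpA P) (kernel_module (modA M) d') \<alpha>' fam_zero"
  obtains \<beta> \<beta>' where "is_ga_map P N X \<beta> \<beta>'"
    "fam_eq (grpG P) (modG M) (\<beta> \<odot> d) \<alpha>" "fam_eq (grpA P) (modA M) (\<beta>' \<odot> d') \<alpha>'"
proof -
  note PD = is_groupoid_pairD[OF P] and MD = is_ga_moduleD[OF M] and ND = is_ga_moduleD[OF N]
    and KD = is_ga_moduleD[OF K]
  have X': "is_ga_module P X" using X by (simp add: rel_injective_module_def)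
  note XD = is_ga_moduleD[OF X']
  have comps: "is_gmap (grpG P) (modG M) (modG N) d" "is_gmap (grpA P) (modA M) (modA N) d'"
    "is_gmap (grpG P) (modG N) (modG K) e" "is_gmap (grpA P) (modA N) (modA K) e'"
    "is_morphism (grpG P) (modG N) (modG M) s" "is_morphism (grpA P) (modA N) (modA M) s'"
    "is_gmap (grpG P) (modG M) (modG X) \<alpha>" "is_gmap (grpA P) (modA M) (modA X) \<alpha>'"
    using d e s \<alpha> by (simp_all add: is_ga_map_def is_ga_morphism_def)
  define Z where "Z = kernel_ga_module N e e'"
  have Z: "is_ga_module P Z" unfolding Z_def by (rule is_ga_module_kernel[OF P N K e])
  note ZD = is_ga_moduleD[OF Z]

  have asd: "fam_eq (grpG P) (modG M) ((\<alpha> \<odot> s) \<odot> d) \<alpha>"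
    "fam_eq (grpA P) (modA M) ((\<alpha>' \<odot> s') \<odot> d') \<alpha>'"
    using fam_eq_comp_section[OF MD(3) ND(3) XD(3) comps(1,5,7) ed(1) ds(1) ker(1)]
      fam_eq_comp_section[OF MD(4) ND(4) XD(4) comps(2,6,8) ed(2) ds(2) ker(2)] by auto
  have "is_ga_morphism P N X (\<alpha> \<odot> s) (\<alpha>' \<odot> s')"
    using is_ga_morphism_comp[OF P N M X' s is_ga_map_imp_morphism[OF \<alpha>]] .
  then have as: "is_ga_map P Z X (\<alpha> \<odot> s) (\<alpha>' \<odot> s')"
    using is_gmap_comp_section[OF PD(1) MD(3) ND(3) KD(3) XD(3) comps(1,3,5,7) ds(1) asd(1)]
      is_gmap_comp_section[OF PD(2) MD(4) ND(4) KD(4) XD(4) comps(2,4,6,8) ds(2) asd(2)]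
    by (simp add: is_ga_map_def is_ga_morphism_def Z_def ga_compatible_iff)

  have r: "is_ga_morphism P N N (d \<odot> s) (d' \<odot> s')"
    using is_ga_morphism_comp[OF P N M N s is_ga_map_imp_morphism[OF d]] .
  \<comment> \<open>Since \<open>e \<odot> d = 0\<close>, the map \<open>d \<odot> s\<close> already
    takes values in \<open>Z\<close>.\<close>
  have rZ: "is_ga_morphism P N Z (d \<odot> s) (d' \<odot> s')"
  proof -
    have "is_morphism (grpG P) (modG N) (kernel_module (modG N) e) (d \<odot> s)"
      using r ed(1) is_morphism_mem[OF comps(5)]
      by (intro is_morphism_corestrict_kernel)
        (auto simp: is_ga_morphism_def fam_eq_def fam_comp_def fam_zero_def)
    moreover have "is_morphism (grpA P) (modA N) (kernel_module (modA N) e') (d' \<odot> s')"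
      using r ed(2) is_morphism_mem[OF comps(6)]
      by (intro is_morphism_corestrict_kernel)
        (auto simp: is_ga_morphism_def fam_eq_def fam_comp_def fam_zero_def)
    ultimately show ?thesis using r by (simp add: is_ga_morphism_def Z_def ga_compatible_iff)
  qed
  obtain b where b: "b > 0"
    "\<And>c. c \<ge> b \<Longrightarrow> sup_norm (grpG P) (scale_module c (modG N)) (modG Z) (d \<odot> s) \<le> 1"
    using bounded_by_scale[OF ND(3) ZD(3)] rZ unfolding is_ga_morphism_def by blast
  obtain b' where b': "b' > 0"
    "\<And>c. c \<ge> b' \<Longrightarrow> sup_norm (grpA P) (scale_module c (modA N)) (modA Z) (d' \<odot> s') \<le> 1"
    using bounded_by_scale[OF ND(4) ZD(4)] rZ unfolding is_ga_morphism_def by blast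
  define c where "c = max b b'"
  have c: "c > 0" using b(1) by (simp add: c_def)
  define N' where "N' = scale_ga_module c N"
  have N': "is_ga_module P N'" unfolding N'_def by (rule is_ga_module_scale[OF P c N])

  \<comment> \<open>The inclusion into the rescaled module may have norm up to \<open>c\<close>.
    This is admissible: a relatively injective map need only be bounded, and the bound 1 concerns
    its retraction.\<close>
  have "is_ga_map P Z N' fam_id fam_id"
  proof -
    have "is_gmap (grpG P) (modG Z) (modG N') fam_id"
      using is_gmap_restrict_kernel[OF is_gmap_id[OF ND(3)]]
        is_gmap_scale_iff[of 1 c, OF _ c ZD(3) ND(3)] by (simp add: Z_def N'_def)
    moreover have "is_gmap (grpA P) (modA Z) (modA N') fam_id"
      using is_gmap_restrict_kernel[OF is_gmap_id[OF ND(4)]]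
        is_gmap_scale_iff[of 1 c, OF _ c ZD(4) ND(4)] by (simp add: Z_def N'_def)
    ultimately show ?thesis
      by (simp add: is_ga_map_def ga_compatible_iff Z_def N'_def fam_id_def)
  qed
  moreover have "is_ga_morphism P N' Z (d \<odot> s) (d' \<odot> s')"
    using rZ is_morphism_scale_iff[of c 1, OF c _ ND(3) ZD(3)]
      is_morphism_scale_iff[of c 1, OF c _ ND(4) ZD(4)]
    by (simp add: is_ga_morphism_def ga_compatible_iff N'_def)
  moreover have "fam_eq (grpG P) (modG Z) ((d \<odot> s) \<odot> fam_id) fam_id"
    "fam_eq (grpA P) (modA Z) ((d' \<odot> s') \<odot> fam_id) fam_id"
    using ds by (simp_all add: Z_def fam_eq_def fam_comp_def fam_id_def)
  moreover have "sup_norm (grpG P) (modG N') (modG Z) (d \<odot> s) \<le> 1"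
    "sup_norm (grpA P) (modA N') (modA Z) (d' \<odot> s') \<le> 1"
    using b(2)[of c] b'(2)[of c] by (simp_all add: N'_def c_def)
  ultimately have "rel_injective_map P Z N' fam_id fam_id"
    unfolding rel_injective_map_def by blast
  with X Z N' as obtain \<beta> \<beta>' where \<beta>: "is_ga_map P N' X \<beta> \<beta>'"
    "fam_eq (grpG P) (modG Z) (\<beta> \<odot> fam_id) (\<alpha> \<odot> s)" "fam_eq (grpA P) (modA Z) (\<beta>' \<odot> fam_id) (\<alpha>' \<odot> s')"
    unfolding rel_injective_module_def by blast
  show thesis
  proof
    show "is_ga_map P N X \<beta> \<beta>'"
      using \<beta>(1) is_gmap_scale_iff[of c 1, OF c _ ND(3) XD(3)] is_gmap_scale_iff[of c 1, OF c _ ND(4) XD(4)]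
      by (simp add: is_ga_map_def ga_compatible_iff N'_def)
    \<comment> \<open>\<open>d x\<close> lies in \<open>Z\<close>, where \<open>\<beta>\<close> is
      \<open>\<alpha> \<odot> s\<close>, and there \<open>asd\<close> gives back
      \<open>\<alpha> x\<close>.\<close>
    show "fam_eq (grpG P) (modG M) (\<beta> \<odot> d) \<alpha>"
      using \<beta>(2) asd(1) ed(1) is_gmap_mem[OF comps(1)]
      by (simp add: fam_eq_def fam_comp_def fam_id_def fam_zero_def Z_def)
    show "fam_eq (grpA P) (modA M) (\<beta>' \<odot> d') \<alpha>'"
      using \<beta>(3) asd(2) ed(2) is_gmap_mem[OF comps(2)]
      by (simp add: fam_eq_def fam_comp_def fam_id_def fam_zero_def Z_def)
  qed
qed


section \<open>The fundamental lemma\<close>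

text \<open>The augmented complex, shifted so that the augmented module sits in degree \<open>0\<close>; with this
  indexing the contraction in degree \<open>n\<close> goes from degree \<open>n + 1\<close> to degree \<open>n\<close>.\<close>

definition aug_deg ::
  "('o, 'm, 'p, 'q) gpair \<Rightarrow> ('o, 'm, 'u) gmodule \<Rightarrow> ('o, 'm, 'p, 'q, 'u) ga_complex \<Rightarrow> nat \<Rightarrow>
    ('o, 'm, 'p, 'q, 'u) ga_module" where
  "aug_deg P V K n = (case n of 0 \<Rightarrow> diag_module P V | Suc m \<Rightarrow> cx_deg K m)"

definition aug_diff :: "('o, 'u) fam \<Rightarrow> (nat \<Rightarrow> ('o, 'u) fam) \<Rightarrow> nat \<Rightarrow> ('o, 'u) fam" where
  "aug_diff \<nu> d n = (case n of 0 \<Rightarrow> \<nu> | Suc m \<Rightarrow> d m)"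

lemma aug_simps [simp]:
  "aug_deg P V K 0 = diag_module P V" "aug_deg P V K (Suc n) = cx_deg K n"
  "aug_diff \<nu> d 0 = \<nu>" "aug_diff \<nu> d (Suc n) = d n"
  by (simp_all add: aug_deg_def aug_diff_def)

lemma cx_deg_simps [simp]:
  "modG (cx_deg K n) = cxG K n" "modA (cx_deg K n) = cxA K n" "conn (cx_deg K n) = cxconn K n"
  by (simp_all add: cx_deg_def)

lemma diag_module_simps [simp]:
  "modG (diag_module P V) = V" "modA (diag_module P V) = pull_module P V"
  "conn (diag_module P V) = fam_id"
  by (simp_all add: diag_module_def)

lemma is_ga_module_aug:
  assumes "is_groupoid_pair P" "banach_module (grpG P) V" "is_ga_complex P K"
  shows "is_ga_module P (aug_deg P V K n)"
  using assms by (cases n) (simp_all add: is_ga_module_diag is_ga_complex_def)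

lemma is_ga_map_aug:
  assumes "is_ga_complex P K" "is_augmentation P V K \<nu> \<nu>'"
  shows "is_ga_map P (aug_deg P V K n) (aug_deg P V K (Suc n)) (aug_diff \<nu> (dG K) n) (aug_diff \<nu>' (dA K) n)"
  using assms by (cases n) (simp_all add: is_augmentation_def is_ga_complex_def)

lemma aug_diff_comp:
  assumes "is_ga_complex P K" "is_augmentation P V K \<nu> \<nu>'"
  shows "fam_eq (grpG P) (modG (aug_deg P V K n)) (aug_diff \<nu> (dG K) (Suc n) \<odot> aug_diff \<nu> (dG K) n) fam_zero"
    and "fam_eq (grpA P) (modA (aug_deg P V K n)) (aug_diff \<nu>' (dA K) (Suc n) \<odot> aug_diff \<nu>' (dA K) n) fam_zero"
  using assms
  by (cases n, simp_all add: is_augmentation_def is_ga_complex_def is_cochain_complex_def)+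

text \<open>In the shifted indexing the identity involving \<open>\<nu> \<odot> s 0\<close> is the
  case \<open>n = 0\<close> of the general one; only \<open>s 0 \<odot> \<nu> = id\<close>, at the
  augmented module itself, stays separate.\<close>

lemma strong_resolution_contraction:
  assumes "is_strong_resolution P V K \<nu> \<nu>'"
  obtains s t where
    "\<And>n. is_ga_morphism P (aug_deg P V K (Suc n)) (aug_deg P V K n) (s n) (t n)"
    "fam_eq (grpG P) V (s 0 \<odot> \<nu>) fam_id" "fam_eq (grpA P) (pull_module P V) (t 0 \<odot> \<nu>') fam_id"
    "\<And>n. fam_eq (grpG P) (modG (aug_deg P V K (Suc n)))
      ((s (Suc n) \<odot> aug_diff \<nu> (dG K) (Suc n)) \<oplus>\<^sub>f (aug_diff \<nu> (dG K) n \<odot> s n)) fam_id"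
    "\<And>n. fam_eq (grpA P) (modA (aug_deg P V K (Suc n)))
      ((t (Suc n) \<odot> aug_diff \<nu>' (dA K) (Suc n)) \<oplus>\<^sub>f (aug_diff \<nu>' (dA K) n \<odot> t n)) fam_id"
proof -
  obtain s t where
    s: "is_cochain_contraction (grpG P) V (cxG K) (dG K) \<nu> s" and
    t: "is_cochain_contraction (grpA P) (pull_module P V) (cxA K) (dA K) \<nu>' t" and
    comp: "ga_compatible P (cx_deg K 0) (diag_module P V) (s 0) (t 0)"
      "\<And>n. ga_compatible P (cx_deg K (Suc n)) (cx_deg K n) (s (Suc n)) (t (Suc n))"
    using assms unfolding is_strong_resolution_def by blast
  have "is_ga_morphism P (aug_deg P V K (Suc n)) (aug_deg P V K n) (s n) (t n)" for n
    using s t comp by (cases n) (simp_all add: is_ga_morphism_def is_cochain_contraction_def)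
  moreover have "fam_eq (grpG P) (modG (aug_deg P V K (Suc n)))
      ((s (Suc n) \<odot> aug_diff \<nu> (dG K) (Suc n)) \<oplus>\<^sub>f (aug_diff \<nu> (dG K) n \<odot> s n)) fam_id" for n
    using s by (cases n) (simp_all add: is_cochain_contraction_def)
  moreover have "fam_eq (grpA P) (modA (aug_deg P V K (Suc n)))
      ((t (Suc n) \<odot> aug_diff \<nu>' (dA K) (Suc n)) \<oplus>\<^sub>f (aug_diff \<nu>' (dA K) n \<odot> t n)) fam_id" for n
    using t by (cases n) (simp_all add: is_cochain_contraction_def)
  ultimately show thesis
    using that s t unfolding is_cochain_contraction_def by blast
qed

section \<open>Exactness from the contraction\<close>

text \<open>On the kernel of \<open>e\<close> the summand \<open>t \<odot> e\<close> drops out,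
  because \<open>t\<close> sends 0 to 0.\<close>

lemma fam_eq_kernel_contraction:
  assumes "fam_eq G V ((t \<odot> e) \<oplus>\<^sub>f (d \<odot> s)) fam_id"
    and "is_morphism G W X t" "normed_module G W"
  shows "fam_eq G (kernel_module V e) (d \<odot> s) fam_id"
  unfolding fam_eq_def
proof (intro ballI)
  fix a x assume a: "a \<in> Ob G" and x: "x \<in> fib (kernel_module V e) a"
  then show "(d \<odot> s) a x = fam_id a x"
    using assms(1) is_morphism_0[OF assms(2,3) a]
    by (auto simp: fam_eq_def fam_comp_def fam_add_def fam_id_def dest!: bspec)
qed

text \<open>A left inverse makes \<open>\<nu>\<close> injective, so its kernel is zero: exactness at
  the augmented module.\<close>

lemma fam_eq_kernel_retract:
  assumes "fam_eq G V (s \<odot> \<nu>) fam_id"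
    and "is_morphism G W U s" "normed_module G W" "is_morphism G V X \<alpha>" "normed_module G V"
  shows "fam_eq G (kernel_module V \<nu>) \<alpha> fam_zero"
  unfolding fam_eq_def
proof (intro ballI)
  fix a x assume a: "a \<in> Ob G" and x: "x \<in> fib (kernel_module V \<nu>) a"
  then have "s a 0 = x" using assms(1) by (auto simp: fam_eq_def fam_comp_def fam_id_def dest!: bspec)
  then have "x = 0" using is_morphism_0[OF assms(2,3) a] by simp
  then show "\<alpha> a x = fam_zero a x"
    using is_morphism_0[OF assms(4,5) a] by (simp add: fam_zero_def)
qed

text \<open>Each \<open>x\<close> in the kernel is \<open>d (s x)\<close>, and
  \<open>\<alpha>\<close> kills the image of \<open>d\<close>.\<close>

lemma fam_eq_kernel_zero:
  assumes "fam_eq G (kernel_module V e) (d \<odot> s) fam_id" "is_morphism G V U s"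
    and "fam_eq G U (\<alpha> \<odot> d) fam_zero"
  shows "fam_eq G (kernel_module V e) \<alpha> fam_zero"
  unfolding fam_eq_def
proof (intro ballI)
  fix a x assume a: "a \<in> Ob G" and x: "x \<in> fib (kernel_module V e) a"
  have "\<alpha> a (d a (s a x)) = 0"
    using assms(3) a is_morphism_mem[OF assms(2) a, of x] x
    by (simp add: fam_eq_def fam_comp_def fam_zero_def)
  then show "\<alpha> a x = fam_zero a x"
    using assms(1) a x by (simp add: fam_eq_def fam_comp_def fam_zero_def fam_id_def)
qed

text \<open>The step common to existence and uniqueness. \<open>\<alpha>\<close> lives in shifted
  degree \<open>n\<close>, and \<open>cx_deg K n\<close> is shifted degree \<open>n + 1\<close>. The
  form of \<open>zero\<close> makes it vacuous for \<open>n = 0\<close>, where nothing precedes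
  \<open>\<nu>\<close> and injectivity takes its place.\<close>

lemma strong_resolution_extend:
  fixes P :: "('o, 'm, 'p, 'q) gpair"
  assumes P: "is_groupoid_pair P" and V: "banach_module (grpG P) V"
    and K: "is_strong_resolution P V K \<nu> \<nu>'" and X: "rel_injective_module P X"
    and \<alpha>: "is_ga_map P (aug_deg P V K n) X \<alpha> \<alpha>'"
    and zero: "\<And>m. n = Suc m \<Longrightarrow>
      fam_eq (grpG P) (modG (aug_deg P V K m)) (\<alpha> \<odot> aug_diff \<nu> (dG K) m) fam_zero \<and>
      fam_eq (grpA P) (modA (aug_deg P V K m)) (\<alpha>' \<odot> aug_diff \<nu>' (dA K) m) fam_zero"
  obtains \<beta> \<beta>' where "is_ga_map P (cx_deg K n) X \<beta> \<beta>'"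
    "fam_eq (grpG P) (modG (aug_deg P V K n)) (\<beta> \<odot> aug_diff \<nu> (dG K) n) \<alpha>"
    "fam_eq (grpA P) (modA (aug_deg P V K n)) (\<beta>' \<odot> aug_diff \<nu>' (dA K) n) \<alpha>'"
proof -
  let ?A = "aug_deg P V K" and ?d = "aug_diff \<nu> (dG K)" and ?d' = "aug_diff \<nu>' (dA K)"
  have K1: "is_ga_complex P K" and K2: "is_augmentation P V K \<nu> \<nu>'"
    using K by (simp_all add: is_strong_resolution_def)
  note A = is_ga_module_aug[OF P V K1] and d = is_ga_map_aug[OF K1 K2] and dd = aug_diff_comp[OF K1 K2]
  obtain s t where s: "\<And>n. is_ga_morphism P (?A (Suc n)) (?A n) (s n) (t n)"
    and s0: "fam_eq (grpG P) V (s 0 \<odot> \<nu>) fam_id" "fam_eq (grpA P) (pull_module P V) (t 0 \<odot> \<nu>') fam_id"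
    and contr: "\<And>n. fam_eq (grpG P) (modG (?A (Suc n))) ((s (Suc n) \<odot> ?d (Suc n)) \<oplus>\<^sub>f (?d n \<odot> s n)) fam_id"
      "\<And>n. fam_eq (grpA P) (modA (?A (Suc n))) ((t (Suc n) \<odot> ?d' (Suc n)) \<oplus>\<^sub>f (?d' n \<odot> t n)) fam_id"
    using strong_resolution_contraction[OF K] by metis
  have sG: "is_morphism (grpG P) (modG (?A (Suc n))) (modG (?A n)) (s n)"
    and sA: "is_morphism (grpA P) (modA (?A (Suc n))) (modA (?A n)) (t n)" for n
    using s[of n] by (auto simp: is_ga_morphism_def)
  have exG: "fam_eq (grpG P) (kernel_module (modG (?A (Suc n))) (?d (Suc n))) (?d n \<odot> s n) fam_id" for n
    using fam_eq_kernel_contraction[OF contr(1) sG is_ga_moduleD(3)[OF A]] .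
  have exA: "fam_eq (grpA P) (kernel_module (modA (?A (Suc n))) (?d' (Suc n))) (?d' n \<odot> t n) fam_id" for n
    using fam_eq_kernel_contraction[OF contr(2) sA is_ga_moduleD(4)[OF A]] .
  have "fam_eq (grpG P) (kernel_module (modG (?A n)) (?d n)) \<alpha> fam_zero \<and>
    fam_eq (grpA P) (kernel_module (modA (?A n)) (?d' n)) \<alpha>' fam_zero"
  proof (cases n)
    case 0
    have "is_morphism (grpG P) V (modG X) \<alpha>" "is_morphism (grpA P) (pull_module P V) (modA X) \<alpha>'"
      using \<alpha> 0 by (auto simp: is_ga_map_def is_gmap_def)
    then show ?thesis
      using 0 fam_eq_kernel_retract[OF s0(1) sG is_ga_moduleD(3)[OF A]]
        fam_eq_kernel_retract[OF s0(2) sA is_ga_moduleD(4)[OF A]]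
        is_ga_moduleD(3,4)[OF A[of 0]] by simp
  next
    case (Suc m)
    then show ?thesis
      using zero[OF Suc] fam_eq_kernel_zero[OF exG sG] fam_eq_kernel_zero[OF exA sA] by simp
  qed
  \<comment> \<open>The modules \<open>M\<close>, \<open>N\<close>, \<open>K\<close> of the
    extension lemma are the shifted degrees \<open>n\<close>, \<open>n + 1\<close> and
    \<open>n + 2\<close>.\<close>
  then obtain \<beta> \<beta>' where "is_ga_map P (?A (Suc n)) X \<beta> \<beta>'"
    "fam_eq (grpG P) (modG (?A n)) (\<beta> \<odot> ?d n) \<alpha>" "fam_eq (grpA P) (modA (?A n)) (\<beta>' \<odot> ?d' n) \<alpha>'"
    using rel_injective_extend[OF P A A A X d d s \<alpha> dd exG exA] by blast
  then show thesis using that by simp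
qed

lemma extension_exists:
  fixes P :: "('o, 'm, 'p, 'q) gpair"
    and V W :: "('o, 'm, 'u::real_vector) gmodule"
    and I C :: "('o, 'm, 'p, 'q, 'u) ga_complex"
  assumes P: "is_groupoid_pair P" and V: "banach_module (grpG P) V" and W: "banach_module (grpG P) W"
    and I: "rel_injective_complex P I" and \<epsilon>: "is_augmentation P W I \<epsilon> \<epsilon>'"
    and C: "is_strong_resolution P V C \<nu> \<nu>'"
    and f: "is_ga_map P (diag_module P V) (diag_module P W) f f'"
  shows "\<exists>F F'. is_ga_cochain_map P C I F F' \<and> extends_map P V \<nu> \<nu>' \<epsilon> \<epsilon>' f f' F F'"
proof -
  let ?A = "aug_deg P V C" and ?d = "aug_diff \<nu> (dG C)" and ?d' = "aug_diff \<nu>' (dA C)"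
  have C1: "is_ga_complex P C" and C2: "is_augmentation P V C \<nu> \<nu>'"
    using C by (simp_all add: is_strong_resolution_def)
  have I1: "is_ga_complex P I" and X: "\<And>n. rel_injective_module P (cx_deg I n)"
    using I by (simp_all add: rel_injective_complex_def)
  have In: "is_ga_module P (cx_deg I n)" for n using I1 by (simp add: is_ga_complex_def)
  have dI: "is_ga_map P (cx_deg I n) (cx_deg I (Suc n)) (dG I n) (dA I n)" for n
    using I1 by (simp add: is_ga_complex_def)
  have ddI: "fam_eq (grpG P) (cxG I n) (dG I (Suc n) \<odot> dG I n) fam_zero"
    "fam_eq (grpA P) (cxA I n) (dA I (Suc n) \<odot> dA I n) fam_zero" for n
    using I1 by (simp_all add: is_ga_complex_def is_cochain_complex_def)
  note A = is_ga_module_aug[OF P V C1]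
  \<comment> \<open>Besides the map in degree \<open>n\<close>, a stage records that its composite
    with the coboundary of \<open>I\<close> kills the image of \<open>?d n\<close>: exactly the
    condition under which this composite can be extended to degree \<open>n + 1\<close>.\<close>
  define S where "S n Z \<longleftrightarrow> is_ga_map P (cx_deg C n) (cx_deg I n) (fst Z) (snd Z) \<and>
      fam_eq (grpG P) (modG (?A n)) (dG I n \<odot> fst Z \<odot> ?d n) fam_zero \<and>
      fam_eq (grpA P) (modA (?A n)) (dA I n \<odot> snd Z \<odot> ?d' n) fam_zero \<and>
      (n = 0 \<longrightarrow> fam_eq (grpG P) V (fst Z \<odot> \<nu>) (\<epsilon> \<odot> f) \<and>
         fam_eq (grpA P) (pull_module P V) (snd Z \<odot> \<nu>') (\<epsilon>' \<odot> f'))" for n Z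
  define Q where "Q n Z Z' \<longleftrightarrow>
      fam_eq (grpG P) (cxG C n) (fst Z' \<odot> dG C n) (dG I n \<odot> fst Z) \<and>
      fam_eq (grpA P) (cxA C n) (snd Z' \<odot> dA C n) (dA I n \<odot> snd Z)"
    for n and Z Z' :: "('o, 'u) fam \<times> ('p, 'u) fam"
  have "\<exists>Z. S 0 Z"
  proof -
    have "is_ga_map P (?A 0) (cx_deg I 0) (\<epsilon> \<odot> f) (\<epsilon>' \<odot> f')"
      using is_ga_map_comp[OF P is_ga_module_diag[OF P V] is_ga_module_diag[OF P W] In f] \<epsilon>
      by (simp add: is_augmentation_def)
    from strong_resolution_extend[OF P V C X this]
    obtain F F' where F: "is_ga_map P (cx_deg C 0) (cx_deg I 0) F F'"
      "fam_eq (grpG P) V (F \<odot> \<nu>) (\<epsilon> \<odot> f)" "fam_eq (grpA P) (pull_module P V) (F' \<odot> \<nu>') (\<epsilon>' \<odot> f')"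
      by auto
    have "is_gmap (grpG P) V W f" "is_gmap (grpA P) (pull_module P V) (pull_module P W) f'"
      using f by (simp_all add: is_ga_map_def)
    note fm = is_gmap_mem[OF this(1)] is_gmap_mem[OF this(2)]
    \<comment> \<open>The invariant starts because \<open>F \<odot> \<nu>\<close> is
      \<open>\<epsilon> \<odot> f\<close>, and the coboundary of \<open>I\<close> vanishes on the
      image of an augmentation.\<close>
    have "S 0 (F, F')"
      using F \<epsilon> fm by (simp add: S_def is_augmentation_def fam_eq_def fam_comp_def fam_zero_def)
    then show ?thesis ..
  qed
  moreover have "\<exists>Z'. S (Suc n) Z' \<and> Q n Z Z'" if Z: "S n Z" for n Z
  proof -
    obtain F F' where ZF: "Z = (F, F')" by (cases Z)
    have F: "is_ga_map P (cx_deg C n) (cx_deg I n) F F'" using Z by (simp add: S_def ZF)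
    have "is_ga_map P (?A (Suc n)) (cx_deg I (Suc n)) (dG I n \<odot> F) (dA I n \<odot> F')"
      using is_ga_map_comp[OF P A[of "Suc n"] In In _ dI] F by simp
    from strong_resolution_extend[OF P V C X this]
    obtain E E' where E: "is_ga_map P (cx_deg C (Suc n)) (cx_deg I (Suc n)) E E'"
      "fam_eq (grpG P) (cxG C n) (E \<odot> dG C n) (dG I n \<odot> F)"
      "fam_eq (grpA P) (cxA C n) (E' \<odot> dA C n) (dA I n \<odot> F')"
      using Z by (auto simp: S_def ZF fam_comp_def)
    have "is_gmap (grpG P) (cxG C n) (cxG I n) F" "is_gmap (grpA P) (cxA C n) (cxA I n) F'"
      using F by (simp_all add: is_ga_map_def)
    note Fm = is_gmap_mem[OF this(1)] is_gmap_mem[OF this(2)]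
    \<comment> \<open>The invariant is passed on: after \<open>dG C n\<close>, \<open>E\<close>
      becomes \<open>dG I n \<odot> F\<close>, which the next coboundary of \<open>I\<close>
      kills.\<close>
    have "S (Suc n) (E, E')"
      using E ddI[of n] Fm by (simp add: S_def fam_eq_def fam_comp_def fam_zero_def)
    moreover have "Q n Z (E, E')" using E by (simp add: Q_def ZF)
    ultimately show ?thesis by blast
  qed
  ultimately obtain H where H: "\<And>n. S n (H n) \<and> Q n (H n) (H (Suc n))"
    using dependent_nat_choice[of S Q] by metis
  have "is_ga_cochain_map P C I (fst \<circ> H) (snd \<circ> H)"
    using H by (simp add: is_ga_cochain_map_def S_def Q_def)
  moreover have "extends_map P V \<nu> \<nu>' \<epsilon> \<epsilon>' f f' (fst \<circ> H) (snd \<circ> H)"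
    using H[of 0] by (simp add: extends_map_def S_def)
  ultimately show ?thesis by blast
qed

text \<open>The difference \<open>R\<close> of the two extensions is a cochain map that vanishes
  after the augmentation. The homotopy is found by solving its defining equation degree by degree
  for the newest component.\<close>

lemma extension_unique:
  fixes P :: "('o, 'm, 'p, 'q) gpair"
    and V :: "('o, 'm, 'u::real_vector) gmodule"
    and I C :: "('o, 'm, 'p, 'q, 'u) ga_complex"
  assumes P: "is_groupoid_pair P" and V: "banach_module (grpG P) V"
    and I: "rel_injective_complex P I" and C: "is_strong_resolution P V C \<nu> \<nu>'"
    and F: "is_ga_cochain_map P C I F F'" "extends_map P V \<nu> \<nu>' \<epsilon> \<epsilon>' f f' F F'"
    and E: "is_ga_cochain_map P C I E E'" "extends_map P V \<nu> \<nu>' \<epsilon> \<epsilon>' f f' E E'"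
  shows "ga_homotopic P C I F F' E E'"
proof -
  let ?A = "aug_deg P V C"
  have C1: "is_ga_complex P C" using C by (simp add: is_strong_resolution_def)
  have I1: "is_ga_complex P I" and X: "\<And>n. rel_injective_module P (cx_deg I n)"
    using I by (simp_all add: rel_injective_complex_def)
  have In: "is_ga_module P (cx_deg I n)" and Cn: "is_ga_module P (cx_deg C n)" for n
    using I1 C1 by (simp_all add: is_ga_complex_def)
  have dI: "is_ga_map P (cx_deg I n) (cx_deg I (Suc n)) (dG I n) (dA I n)" for n
    using I1 by (simp_all add: is_ga_complex_def)
  have ddI: "fam_eq (grpG P) (cxG I n) (dG I (Suc n) \<odot> dG I n) fam_zero"
    "fam_eq (grpA P) (cxA I n) (dA I (Suc n) \<odot> dA I n) fam_zero" for n
    using I1 by (simp_all add: is_ga_complex_def is_cochain_complex_def)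
  define R where "R n = F n \<ominus>\<^sub>f E n" for n
  define R' where "R' n = F' n \<ominus>\<^sub>f E' n" for n
  have R: "is_ga_map P (cx_deg C n) (cx_deg I n) (R n) (R' n)" for n
    unfolding R_def R'_def using F(1) E(1)
    by (intro is_ga_map_diff[OF P Cn In]) (simp_all add: is_ga_cochain_map_def)
  have RG: "is_gmap (grpG P) (cxG C n) (cxG I n) (R n)"
    and RA: "is_gmap (grpA P) (cxA C n) (cxA I n) (R' n)" for n
    using R[of n] by (simp_all add: is_ga_map_def)
  have dIG: "is_gmap (grpG P) (cxG I n) (cxG I (Suc n)) (dG I n)"
    and dIA: "is_gmap (grpA P) (cxA I n) (cxA I (Suc n)) (dA I n)" for n
    using dI[of n] by (simp_all add: is_ga_map_def)
  have nG: "normed_module (grpG P) (cxG I n)" and nA: "normed_module (grpA P) (cxA I n)" for n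
    using is_ga_moduleD(3,4)[OF In[of n]] by simp_all
  have Rd: "fam_eq (grpG P) (cxG C n) (R (Suc n) \<odot> dG C n) (dG I n \<odot> R n)" for n
    unfolding fam_eq_def
  proof (intro ballI)
    fix e x assume e: "e \<in> Ob (grpG P)" and x: "x \<in> fib (cxG C n) e"
    have "F n e x \<in> fib (cxG I n) e" "E n e x \<in> fib (cxG I n) e"
      using F(1) E(1) e x by (auto simp: is_ga_cochain_map_def is_ga_map_def intro: is_gmap_mem)
    then show "(R (Suc n) \<odot> dG C n) e x = (dG I n \<odot> R n) e x"
      using F(1) E(1) e x is_morphism_diff[OF is_gmap_morphism[OF dIG] nG e]
      by (simp add: is_ga_cochain_map_def fam_eq_def fam_comp_def fam_diff_def R_def)
  qed
  have Rd': "fam_eq (grpA P) (cxA C n) (R' (Suc n) \<odot> dA C n) (dA I n \<odot> R' n)" for n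
    unfolding fam_eq_def
  proof (intro ballI)
    fix e x assume e: "e \<in> Ob (grpA P)" and x: "x \<in> fib (cxA C n) e"
    have "F' n e x \<in> fib (cxA I n) e" "E' n e x \<in> fib (cxA I n) e"
      using F(1) E(1) e x by (auto simp: is_ga_cochain_map_def is_ga_map_def intro: is_gmap_mem)
    then show "(R' (Suc n) \<odot> dA C n) e x = (dA I n \<odot> R' n) e x"
      using F(1) E(1) e x is_morphism_diff[OF is_gmap_morphism[OF dIA] nA e]
      by (simp add: is_ga_cochain_map_def fam_eq_def fam_comp_def fam_diff_def R'_def)
  qed
  \<comment> \<open>The homotopy equation in degree \<open>n\<close> also contains the preceding
    component; applying the coboundary of \<open>I\<close> removes that term, leaving an invariant
    of one stage. With the cochain property of \<open>R\<close> it makes the next map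
    \<open>T\<close> vanish after \<open>dG C n\<close>.\<close>
  define S where "S n Z \<longleftrightarrow> is_ga_map P (cx_deg C (Suc n)) (cx_deg I n) (fst Z) (snd Z) \<and>
      fam_eq (grpG P) (cxG C n) (dG I n \<odot> fst Z \<odot> dG C n) (dG I n \<odot> R n) \<and>
      fam_eq (grpA P) (cxA C n) (dA I n \<odot> snd Z \<odot> dA C n) (dA I n \<odot> R' n) \<and>
      (n = 0 \<longrightarrow> fam_eq (grpG P) (cxG C 0) (fst Z \<odot> dG C 0) (R 0) \<and>
         fam_eq (grpA P) (cxA C 0) (snd Z \<odot> dA C 0) (R' 0))" for n Z
  \<comment> \<open>The homotopy equation solved for its last term, the form in which an extension
    along \<open>dG C (Suc n)\<close> delivers it.\<close>
  define Q where "Q n Z Z' \<longleftrightarrow>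
      fam_eq (grpG P) (cxG C (Suc n)) (fst Z' \<odot> dG C (Suc n)) (R (Suc n) \<ominus>\<^sub>f (dG I n \<odot> fst Z)) \<and>
      fam_eq (grpA P) (cxA C (Suc n)) (snd Z' \<odot> dA C (Suc n)) (R' (Suc n) \<ominus>\<^sub>f (dA I n \<odot> snd Z))"
    for n and Z Z' :: "('o, 'u) fam \<times> ('p, 'u) fam"
  have "\<exists>Z. S 0 Z"
  proof -
    \<comment> \<open>Degree 0 of \<open>C\<close> is shifted degree 1, so \<open>R 0\<close> has to
      kill the image of \<open>\<nu>\<close>; it does, since both extensions agree there with
      \<open>\<epsilon> \<odot> f\<close>.\<close>
    have R0: "is_ga_map P (?A (Suc 0)) (cx_deg I 0) (R 0) (R' 0)" using R by simp
    obtain H H' where H: "is_ga_map P (cx_deg C (Suc 0)) (cx_deg I 0) H H'"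
      "fam_eq (grpG P) (cxG C 0) (H \<odot> dG C 0) (R 0)" "fam_eq (grpA P) (cxA C 0) (H' \<odot> dA C 0) (R' 0)"
      using strong_resolution_extend[OF P V C X R0] F(2) E(2)
      by (auto simp: extends_map_def fam_eq_def fam_comp_def fam_diff_def fam_zero_def R_def R'_def)
    then have "S 0 (H, H')" by (simp add: S_def fam_eq_def fam_comp_def)
    then show ?thesis ..
  qed
  moreover have "\<exists>Z'. S (Suc n) Z' \<and> Q n Z Z'" if Z: "S n Z" for n Z
  proof -
    obtain H H' where ZH: "Z = (H, H')" by (cases Z)
    have H: "is_ga_map P (cx_deg C (Suc n)) (cx_deg I n) H H'" using Z by (simp add: S_def ZH)
    have HG: "is_gmap (grpG P) (cxG C (Suc n)) (cxG I n) H"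
      and HA: "is_gmap (grpA P) (cxA C (Suc n)) (cxA I n) H'"
      using H by (simp_all add: is_ga_map_def)
    define T where "T = R (Suc n) \<ominus>\<^sub>f (dG I n \<odot> H)"
    define T' where "T' = R' (Suc n) \<ominus>\<^sub>f (dA I n \<odot> H')"
    have T: "is_ga_map P (?A (Suc (Suc n))) (cx_deg I (Suc n)) T T'"
      using is_ga_map_diff[OF P Cn In R is_ga_map_comp[OF P Cn In In H dI]] by (simp add: T_def T'_def)
    have zero: "fam_eq (grpG P) (cxG C n) (T \<odot> dG C n) fam_zero"
      "fam_eq (grpA P) (cxA C n) (T' \<odot> dA C n) fam_zero"
      using Z Rd[of n] Rd'[of n]
      by (simp_all add: S_def ZH T_def T'_def fam_eq_def fam_comp_def fam_diff_def fam_zero_def)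
    obtain L L' where L: "is_ga_map P (cx_deg C (Suc (Suc n))) (cx_deg I (Suc n)) L L'"
      "fam_eq (grpG P) (cxG C (Suc n)) (L \<odot> dG C (Suc n)) T"
      "fam_eq (grpA P) (cxA C (Suc n)) (L' \<odot> dA C (Suc n)) T'"
      using strong_resolution_extend[OF P V C X T] zero by auto
    \<comment> \<open>\<open>T\<close> and \<open>R (Suc n)\<close> differ by a coboundary in
      \<open>I\<close>, which the next coboundary kills; so an \<open>L\<close> with
      \<open>L \<odot> dG C (Suc n) = T\<close> satisfies the invariant for
      \<open>R\<close>.\<close>
    have "dG I (Suc n) e (T e x) = dG I (Suc n) e (R (Suc n) e x)"
      if e: "e \<in> Ob (grpG P)" and x: "x \<in> fib (cxG C (Suc n)) e" for e x
      using is_morphism_diff[OF is_gmap_morphism[OF dIG] nG e is_gmap_mem[OF RG e x]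
          is_gmap_mem[OF dIG e is_gmap_mem[OF HG e x]]] ddI(1)[of n] e is_gmap_mem[OF HG e x]
      by (simp add: T_def fam_diff_def fam_comp_def fam_eq_def fam_zero_def)
    moreover have "dA I (Suc n) e (T' e x) = dA I (Suc n) e (R' (Suc n) e x)"
      if e: "e \<in> Ob (grpA P)" and x: "x \<in> fib (cxA C (Suc n)) e" for e x
      using is_morphism_diff[OF is_gmap_morphism[OF dIA] nA e is_gmap_mem[OF RA e x]
          is_gmap_mem[OF dIA e is_gmap_mem[OF HA e x]]] ddI(2)[of n] e is_gmap_mem[OF HA e x]
      by (simp add: T'_def fam_diff_def fam_comp_def fam_eq_def fam_zero_def)
    ultimately have "S (Suc n) (L, L')"
      using L by (simp add: S_def fam_eq_def fam_comp_def)
    moreover have "Q n Z (L, L')" using L by (simp add: Q_def ZH T_def T'_def)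
    ultimately show ?thesis by blast
  qed
  ultimately obtain H where H: "\<And>n. S n (H n) \<and> Q n (H n) (H (Suc n))"
    using dependent_nat_choice[of S Q] by metis
  have "is_cochain_homotopy (grpG P) (cxG C) (dG C) (dG I) F E (fst \<circ> H)"
    "is_cochain_homotopy (grpA P) (cxA C) (dA C) (dA I) F' E' (snd \<circ> H)"
    using H[of 0] H
    by (simp_all add: is_cochain_homotopy_def S_def Q_def R_def R'_def fam_eq_def fam_comp_def
        fam_diff_def fam_add_def)
  moreover have "is_ga_map P (cx_deg C (Suc n)) (cx_deg I n) ((fst \<circ> H) n) ((snd \<circ> H) n)" for n
    using H[of n] by (simp add: S_def)
  ultimately show ?thesis unfolding ga_homotopic_def by blast
qed

theorem proposition4p18:
  fixes P :: "('o, 'm, 'p, 'q) gpair"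
    and V W :: "('o, 'm, 'u::real_vector) gmodule"
    and I C :: "('o, 'm, 'p, 'q, 'u) ga_complex"
    and \<epsilon> \<nu> f :: "('o, 'u) fam"
    and \<epsilon>' \<nu>' f' :: "('p, 'u) fam"
  assumes "is_groupoid_pair P"
    and "banach_module (grpG P) V"
    and "banach_module (grpG P) W"
    and "rel_injective_complex P I"
    and "is_augmentation P W I \<epsilon> \<epsilon>'"
    and "is_strong_resolution P V C \<nu> \<nu>'"
    and "is_ga_map P (diag_module P V) (diag_module P W) f f'"
  shows "(\<exists>F F'. is_ga_cochain_map P C I F F' \<and> extends_map P V \<nu> \<nu>' \<epsilon> \<epsilon>' f f' F F') \<and>
    (\<forall>F F' E E'.
       is_ga_cochain_map P C I F F' \<and> extends_map P V \<nu> \<nu>' \<epsilon> \<epsilon>' f f' F F' \<and>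
       is_ga_cochain_map P C I E E' \<and> extends_map P V \<nu> \<nu>' \<epsilon> \<epsilon>' f f' E E' \<longrightarrow>
       ga_homotopic P C I F F' E E')"
  using extension_exists[OF assms] extension_unique[OF assms(1,2,4,6)] by blast

end
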